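(* Let $\mathcal{A}$ be an abelian category with small $\operatorname{Ext}$ groups and $\mathcal{E}$ an exact structure on $\mathcal{A}$ such that $\mathcal{A}$ has enough $\mathcal{E}$-projectives and enough $\mathcal{E}$-injectives. Let $(\mathcal{X},\mathcal{Y})$ be a pair of full subcategories of $\mathcal{A}$. Then the following statements are equivalent. (1) $\mathcal{X}$ is $\mathcal{E}$-resolving, $\mathcal{Y}=\mathcal{X}^{\bot_{\ast}}$, and each $A\in\mathcal{A}$ admits an epimorphic $\mathcal{X}$-precover $p:X\to A$ such that $\operatorname{Ker} p\in\mathcal{Y}$. (2) $\mathcal{Y}$ is $\mathcal{E}$-coresolving, $\mathcal{X}={}^{\bot_{\ast}}\mathcal{Y}$, and each $A\in\mathcal{A}$ admits a monomorphic $\mathcal{Y}$-preenvelope $j:A\to Y$ such that $\operatorname{Coker} j\in\mathcal{X}$. (3) $(\mathcal{X},\mathcal{Y})$ is a complete hereditary $\mathcal{E}$-cotorsion pair.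
   Context: Small Ext groups: $\operatorname{Ext}^1_{\mathcal{A}}(X,Y)$ is a set for all $X,Y$. A subcategory of $\mathcal{A}$ means a full and additive subcategory closed under isomorphisms and direct summands. Exact structure: a kernel-cokernel pair $(i,p)$ is a composable pair $L\xrightarrow{i}M\xrightarrow{p}N$ with $i$ a kernel of $p$ and $p$ a cokernel of $i$. For a class $\mathcal{E}$ of such pairs, $i$ (resp. $p$) is an admissible monic (resp. admissible epic) if it is the first (resp. second) morphism of a pair in $\mathcal{E}$. $\mathcal{E}$ is an exact structure if it is closed under isomorphisms and: identities are both admissible monics and admissible epics; admissible monics (resp. epics) are closed under composition; push-outs of admissible monics along arbitrary morphisms exist and are admissible monics; pull-backs of admissible epics along arbitrary morphisms exist and are admissible epics. Elements of $\mathcal{E}$ are called conflations, written $0\to L\to M\to N\to 0$. $P$ is $\mathcal{E}$-projective if every morphism $P\to N$ lifts along every admissible epic $M\to N$; $I$ is $\mathcal{E}$-injective if every morphism $L\to I$ extends along every admissible monic $L\to M$. Enough $\mathcal{E}$-projectives (resp. $\mathcal{E}$-injectives): every object $M$ admits an admissible epic $P\to M$ with $P$ $\mathcal{E}$-projective (resp. an admissible monic $M\to I$ with $I$ $\mathcal{E}$-injective). $\mathcal{E}\mathrm{xt}^{i}_{\mathcal{A}}(M,N)$, $i\ge 1$, is the $i$-th cohomology group obtained by applying $\operatorname{Hom}_{\mathcal{A}}(-,N)$ to an $\mathcal{E}$-projective resolution of $M$ (built from conflations), or equivalently $\operatorname{Hom}_{\mathcal{A}}(M,-)$ to an $\mathcal{E}$-injective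 coresolution of $N$. Put $\mathcal{X}^{\bot_{\ast}}=\{N\in\mathcal{A}\mid \mathcal{E}\mathrm{xt}^1_{\mathcal{A}}(M,N)=0 \text{ for all } M\in\mathcal{X}\}$ and ${}^{\bot_{\ast}}\mathcal{Y}=\{M\in\mathcal{A}\mid \mathcal{E}\mathrm{xt}^1_{\mathcal{A}}(M,N)=0\text{ for all }N\in\mathcal{Y}\}$. $(\mathcal{X},\mathcal{Y})$ is an $\mathcal{E}$-cotorsion pair if $\mathcal{X}={}^{\bot_{\ast}}\mathcal{Y}$ and $\mathcal{Y}=\mathcal{X}^{\bot_{\ast}}$. It is complete if for every $M\in\mathcal{A}$ there are conflations $0\to Y\to X\to M\to 0$ and $0\to M\to Y'\to X'\to 0$ with $X,X'\in\mathcal{X}$ and $Y,Y'\in\mathcal{Y}$. It is hereditary if $\mathcal{X}$ is $\mathcal{E}$-resolving. A subcategory $\mathcal{T}$ is closed under $\mathcal{E}$-extensions if whenever the end terms of a conflation are in $\mathcal{T}$, so is the middle term. $\mathcal{T}$ is $\mathcal{E}$-resolving if it contains all $\mathcal{E}$-projectives, is closed under $\mathcal{E}$-extensions, and for every conflation $0\to X\to Y\to Z\to 0$ with $Y,Z\in\mathcal{T}$ one has $X\in\mathcal{T}$. Dually, $\mathcal{T}$ is $\mathcal{E}$-coresolving if it contains all $\mathcal{E}$-injectives, is closed under $\mathcal{E}$-extensions, and for every conflation $0\to X\to Y\to Z\to 0$ with $X,Y\in\mathcal{T}$ one has $Z\in\mathcal{T}$. An $\mathcal{X}$-precover of $A$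 is a morphism $p:X\to A$ with $X\in\mathcal{X}$ such that every morphism $X'\to A$ with $X'\in\mathcal{X}$ factors through $p$; a $\mathcal{Y}$-preenvelope of $A$ is a morphism $j:A\to Y$ with $Y\in\mathcal{Y}$ such that every morphism $A\to Y'$ with $Y'\in\mathcal{Y}$ factors through $j$. Epimorphic (resp. monomorphic) means that the morphism is an epimorphism (resp. monomorphism) in $\mathcal{A}$. *)

theory Defs
  imports "HOL-Algebra.Coset" "HOL-Algebra.Elementary_Groups"
begin

text \<open>A category is given by its objects, its arrows, and partial operations that are only
  meaningful on objects, resp. on composable or parallel arrows. The additive structure on the
  Hom-sets is part of the data; on an abelian category it is uniquely determined.
  Since all Hom-sets and all classes of conflations are HOL sets, smallness of the Ext groups
  is automatic and is not listed as a hypothesis.\<close>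

record ('o, 'm) cat =
  Ob :: "'o set"
  Ar :: "'m set"
  src :: "'m \<Rightarrow> 'o"
  tgt :: "'m \<Rightarrow> 'o"
  ident :: "'o \<Rightarrow> 'm"
  cmp :: "'m \<Rightarrow> 'm \<Rightarrow> 'm" (infixl \<open>\<cdot>\<index>\<close> 75)
  zero_ar :: "'o \<Rightarrow> 'o \<Rightarrow> 'm"
  plus_ar :: "'m \<Rightarrow> 'm \<Rightarrow> 'm"

definition Mor :: "('o, 'm) cat \<Rightarrow> 'o \<Rightarrow> 'o \<Rightarrow> 'm set" where
  "Mor C A B = {f \<in> Ar C. src C f = A \<and> tgt C f = B}"

definition Mor_group :: "('o, 'm) cat \<Rightarrow> 'o \<Rightarrow> 'o \<Rightarrow> 'm monoid" where
  "Mor_group C A B = \<lparr>carrier = Mor C A B, monoid.mult = plus_ar C, one = zero_ar C A B\<rparr>"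

locale category =
  fixes C :: "('o, 'm) cat" (structure)
  assumes src_Ob: "f \<in> Ar C \<Longrightarrow> src C f \<in> Ob C"
    and tgt_Ob: "f \<in> Ar C \<Longrightarrow> tgt C f \<in> Ob C"
    and ident_Mor: "A \<in> Ob C \<Longrightarrow> ident C A \<in> Mor C A A"
    and cmp_Mor: "f \<in> Mor C A B \<Longrightarrow> g \<in> Mor C B D \<Longrightarrow> g \<cdot> f \<in> Mor C A D"
    and cmp_ident_right: "f \<in> Mor C A B \<Longrightarrow> f \<cdot> ident C A = f"
    and cmp_ident_left: "f \<in> Mor C A B \<Longrightarrow> ident C B \<cdot> f = f"
    and cmp_assoc: "f \<in> Mor C A B \<Longrightarrow> g \<in> Mor C B D \<Longrightarrow> h \<in> Mor C D E \<Longrightarrow>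
      h \<cdot> (g \<cdot> f) = (h \<cdot> g) \<cdot> f"

locale preadditive_category = category +
  assumes Mor_comm_group: "A \<in> Ob C \<Longrightarrow> B \<in> Ob C \<Longrightarrow> comm_group (Mor_group C A B)"
    and cmp_plus_right: "f \<in> Mor C A B \<Longrightarrow> f' \<in> Mor C A B \<Longrightarrow> g \<in> Mor C B D \<Longrightarrow>
      g \<cdot> plus_ar C f f' = plus_ar C (g \<cdot> f) (g \<cdot> f')"
    and cmp_plus_left: "f \<in> Mor C A B \<Longrightarrow> g \<in> Mor C B D \<Longrightarrow> g' \<in> Mor C B D \<Longrightarrow>
      plus_ar C g g' \<cdot> f = plus_ar C (g \<cdot> f) (g' \<cdot> f)"

definition is_iso :: "('o, 'm) cat \<Rightarrow> 'm \<Rightarrow> bool" where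
  "is_iso C f \<longleftrightarrow> f \<in> Ar C \<and> (\<exists>g \<in> Mor C (tgt C f) (src C f).
     g \<cdot>\<^bsub>C\<^esub> f = ident C (src C f) \<and> f \<cdot>\<^bsub>C\<^esub> g = ident C (tgt C f))"

definition is_mono :: "('o, 'm) cat \<Rightarrow> 'm \<Rightarrow> bool" where
  "is_mono C f \<longleftrightarrow> f \<in> Ar C \<and>
     (\<forall>A \<in> Ob C. \<forall>g \<in> Mor C A (src C f). \<forall>h \<in> Mor C A (src C f).
        f \<cdot>\<^bsub>C\<^esub> g = f \<cdot>\<^bsub>C\<^esub> h \<longrightarrow> g = h)"

definition is_epi :: "('o, 'm) cat \<Rightarrow> 'm \<Rightarrow> bool" where
  "is_epi C f \<longleftrightarrow> f \<in> Ar C \<and>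
     (\<forall>A \<in> Ob C. \<forall>g \<in> Mor C (tgt C f) A. \<forall>h \<in> Mor C (tgt C f) A.
        g \<cdot>\<^bsub>C\<^esub> f = h \<cdot>\<^bsub>C\<^esub> f \<longrightarrow> g = h)"

definition is_zero_object :: "('o, 'm) cat \<Rightarrow> 'o \<Rightarrow> bool" where
  "is_zero_object C Z \<longleftrightarrow> Z \<in> Ob C \<and>
     (\<forall>A \<in> Ob C. (\<exists>!f. f \<in> Mor C Z A) \<and> (\<exists>!f. f \<in> Mor C A Z))"

definition is_biproduct :: "('o, 'm) cat \<Rightarrow> 'o \<Rightarrow> 'o \<Rightarrow> 'o \<Rightarrow> bool" where
  "is_biproduct C A B S \<longleftrightarrow> A \<in> Ob C \<and> B \<in> Ob C \<and> S \<in> Ob C \<and>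
     (\<exists>i1 \<in> Mor C A S. \<exists>i2 \<in> Mor C B S. \<exists>p1 \<in> Mor C S A. \<exists>p2 \<in> Mor C S B.
        p1 \<cdot>\<^bsub>C\<^esub> i1 = ident C A \<and> p2 \<cdot>\<^bsub>C\<^esub> i2 = ident C B \<and>
        p2 \<cdot>\<^bsub>C\<^esub> i1 = zero_ar C A B \<and> p1 \<cdot>\<^bsub>C\<^esub> i2 = zero_ar C B A \<and>
        plus_ar C (i1 \<cdot>\<^bsub>C\<^esub> p1) (i2 \<cdot>\<^bsub>C\<^esub> p2) = ident C S)"

definition is_kernel :: "('o, 'm) cat \<Rightarrow> 'm \<Rightarrow> 'm \<Rightarrow> bool" where
  "is_kernel C i p \<longleftrightarrow> i \<in> Ar C \<and> p \<in> Ar C \<and> tgt C i = src C p \<and>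
     p \<cdot>\<^bsub>C\<^esub> i = zero_ar C (src C i) (tgt C p) \<and>
     (\<forall>A \<in> Ob C. \<forall>f \<in> Mor C A (src C p). p \<cdot>\<^bsub>C\<^esub> f = zero_ar C A (tgt C p) \<longrightarrow>
        (\<exists>!g. g \<in> Mor C A (src C i) \<and> i \<cdot>\<^bsub>C\<^esub> g = f))"

definition is_cokernel :: "('o, 'm) cat \<Rightarrow> 'm \<Rightarrow> 'm \<Rightarrow> bool" where
  "is_cokernel C p i \<longleftrightarrow> i \<in> Ar C \<and> p \<in> Ar C \<and> tgt C i = src C p \<and>
     p \<cdot>\<^bsub>C\<^esub> i = zero_ar C (src C i) (tgt C p) \<and>
     (\<forall>A \<in> Ob C. \<forall>f \<in> Mor C (tgt C i) A. f \<cdot>\<^bsub>C\<^esub> i = zero_ar C (src C i) A \<longrightarrow>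
        (\<exists>!g. g \<in> Mor C (tgt C p) A \<and> g \<cdot>\<^bsub>C\<^esub> p = f))"

locale abelian_category = preadditive_category +
  assumes zero_object: "\<exists>Z. is_zero_object C Z"
    and biproduct: "A \<in> Ob C \<Longrightarrow> B \<in> Ob C \<Longrightarrow> \<exists>S. is_biproduct C A B S"
    and kernel: "f \<in> Ar C \<Longrightarrow> \<exists>k. is_kernel C k f"
    and cokernel: "f \<in> Ar C \<Longrightarrow> \<exists>c. is_cokernel C c f"
    and mono_normal: "is_mono C f \<Longrightarrow> \<exists>g. is_kernel C f g"
    and epi_normal: "is_epi C f \<Longrightarrow> \<exists>g. is_cokernel C f g"

text \<open>The square \<open>f \<cdot> q = g \<cdot> q'\<close> with \<open>q\<close> opposite to \<open>g\<close>.\<close>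

definition is_pullback :: "('o, 'm) cat \<Rightarrow> 'm \<Rightarrow> 'm \<Rightarrow> 'm \<Rightarrow> 'm \<Rightarrow> bool" where
  "is_pullback C f g q q' \<longleftrightarrow>
     f \<in> Ar C \<and> g \<in> Ar C \<and> tgt C f = tgt C g \<and> q \<in> Ar C \<and> q' \<in> Ar C \<and>
     src C q = src C q' \<and> tgt C q = src C f \<and> tgt C q' = src C g \<and>
     f \<cdot>\<^bsub>C\<^esub> q = g \<cdot>\<^bsub>C\<^esub> q' \<and>
     (\<forall>A \<in> Ob C. \<forall>u \<in> Mor C A (src C f). \<forall>v \<in> Mor C A (src C g).
        f \<cdot>\<^bsub>C\<^esub> u = g \<cdot>\<^bsub>C\<^esub> v \<longrightarrow>
        (\<exists>!w. w \<in> Mor C A (src C q) \<and> q \<cdot>\<^bsub>C\<^esub> w = u \<and> q' \<cdot>\<^bsub>C\<^esub> w = v))"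

text \<open>The square \<open>q \<cdot> f = q' \<cdot> g\<close> with \<open>q\<close> opposite to \<open>g\<close>.\<close>

definition is_pushout :: "('o, 'm) cat \<Rightarrow> 'm \<Rightarrow> 'm \<Rightarrow> 'm \<Rightarrow> 'm \<Rightarrow> bool" where
  "is_pushout C f g q q' \<longleftrightarrow>
     f \<in> Ar C \<and> g \<in> Ar C \<and> src C f = src C g \<and> q \<in> Ar C \<and> q' \<in> Ar C \<and>
     tgt C q = tgt C q' \<and> src C q = tgt C f \<and> src C q' = tgt C g \<and>
     q \<cdot>\<^bsub>C\<^esub> f = q' \<cdot>\<^bsub>C\<^esub> g \<and>
     (\<forall>A \<in> Ob C. \<forall>u \<in> Mor C (tgt C f) A. \<forall>v \<in> Mor C (tgt C g) A.
        u \<cdot>\<^bsub>C\<^esub> f = v \<cdot>\<^bsub>C\<^esub> g \<longrightarrow>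
        (\<exists>!w. w \<in> Mor C (tgt C q) A \<and> w \<cdot>\<^bsub>C\<^esub> q = u \<and> w \<cdot>\<^bsub>C\<^esub> q' = v))"

definition kernel_cokernel_pair :: "('o, 'm) cat \<Rightarrow> 'm \<Rightarrow> 'm \<Rightarrow> bool" where
  "kernel_cokernel_pair C i p \<longleftrightarrow> is_kernel C i p \<and> is_cokernel C p i"

definition pair_iso :: "('o, 'm) cat \<Rightarrow> 'm \<times> 'm \<Rightarrow> 'm \<times> 'm \<Rightarrow> bool" where
  "pair_iso C = (\<lambda>(i, p) (i', p'). \<exists>a b c. is_iso C a \<and> is_iso C b \<and> is_iso C c \<and>
     a \<in> Mor C (src C i) (src C i') \<and> b \<in> Mor C (tgt C i) (tgt C i') \<and>
     c \<in> Mor C (tgt C p) (tgt C p') \<and>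
     b \<cdot>\<^bsub>C\<^esub> i = i' \<cdot>\<^bsub>C\<^esub> a \<and> c \<cdot>\<^bsub>C\<^esub> p = p' \<cdot>\<^bsub>C\<^esub> b)"

definition adm_monic :: "('m \<times> 'm) set \<Rightarrow> 'm \<Rightarrow> bool" where
  "adm_monic \<E> i \<longleftrightarrow> (\<exists>p. (i, p) \<in> \<E>)"

definition adm_epic :: "('m \<times> 'm) set \<Rightarrow> 'm \<Rightarrow> bool" where
  "adm_epic \<E> p \<longleftrightarrow> (\<exists>i. (i, p) \<in> \<E>)"

locale exact_structure = abelian_category +
  fixes \<E> :: "('m \<times> 'm) set"
  assumes conflation_pair: "(i, p) \<in> \<E> \<Longrightarrow> kernel_cokernel_pair C i p"
    and conflation_iso: "(i, p) \<in> \<E> \<Longrightarrow> i' \<in> Ar C \<Longrightarrow> p' \<in> Ar C \<Longrightarrow> tgt C i' = src C p' \<Longrightarrow>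
      pair_iso C (i, p) (i', p') \<Longrightarrow> (i', p') \<in> \<E>"
    and ident_adm_monic: "A \<in> Ob C \<Longrightarrow> adm_monic \<E> (ident C A)"
    and ident_adm_epic: "A \<in> Ob C \<Longrightarrow> adm_epic \<E> (ident C A)"
    and cmp_adm_monic: "adm_monic \<E> i \<Longrightarrow> adm_monic \<E> j \<Longrightarrow> tgt C i = src C j \<Longrightarrow>
      adm_monic \<E> (j \<cdot> i)"
    and cmp_adm_epic: "adm_epic \<E> p \<Longrightarrow> adm_epic \<E> q \<Longrightarrow> tgt C p = src C q \<Longrightarrow>
      adm_epic \<E> (q \<cdot> p)"
    and pushout_ex: "adm_monic \<E> i \<Longrightarrow> f \<in> Ar C \<Longrightarrow> src C f = src C i \<Longrightarrow>
      \<exists>f' i'. is_pushout C i f f' i'"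
    and pushout_adm_monic: "adm_monic \<E> i \<Longrightarrow> is_pushout C i f f' i' \<Longrightarrow> adm_monic \<E> i'"
    and pullback_ex: "adm_epic \<E> p \<Longrightarrow> f \<in> Ar C \<Longrightarrow> tgt C f = tgt C p \<Longrightarrow>
      \<exists>f' p'. is_pullback C p f f' p'"
    and pullback_adm_epic: "adm_epic \<E> p \<Longrightarrow> is_pullback C p f f' p' \<Longrightarrow> adm_epic \<E> p'"

definition E_projective :: "('o, 'm) cat \<Rightarrow> ('m \<times> 'm) set \<Rightarrow> 'o \<Rightarrow> bool" where
  "E_projective C \<E> P \<longleftrightarrow> P \<in> Ob C \<and>
     (\<forall>p. adm_epic \<E> p \<longrightarrow> (\<forall>f \<in> Mor C P (tgt C p). \<exists>g \<in> Mor C P (src C p). p \<cdot>\<^bsub>C\<^esub> g = f))"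

definition E_injective :: "('o, 'm) cat \<Rightarrow> ('m \<times> 'm) set \<Rightarrow> 'o \<Rightarrow> bool" where
  "E_injective C \<E> I \<longleftrightarrow> I \<in> Ob C \<and>
     (\<forall>i. adm_monic \<E> i \<longrightarrow> (\<forall>f \<in> Mor C (src C i) I. \<exists>g \<in> Mor C (tgt C i) I. g \<cdot>\<^bsub>C\<^esub> i = f))"

definition enough_E_projectives :: "('o, 'm) cat \<Rightarrow> ('m \<times> 'm) set \<Rightarrow> bool" where
  "enough_E_projectives C \<E> \<longleftrightarrow>
     (\<forall>M \<in> Ob C. \<exists>p. adm_epic \<E> p \<and> E_projective C \<E> (src C p) \<and> tgt C p = M)"

definition enough_E_injectives :: "('o, 'm) cat \<Rightarrow> ('m \<times> 'm) set \<Rightarrow> bool" where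
  "enough_E_injectives C \<E> \<longleftrightarrow>
     (\<forall>M \<in> Ob C. \<exists>i. adm_monic \<E> i \<and> src C i = M \<and> E_injective C \<E> (tgt C i))"

text \<open>An \<open>\<E>\<close>-projective resolution of \<open>M\<close> is a sequence of conflations
  \<open>0 \<rightarrow> K\<^bsub>n+1\<^esub> \<rightarrow> P\<^bsub>n\<^esub> \<rightarrow> K\<^bsub>n\<^esub> \<rightarrow> 0\<close> with \<open>K\<^bsub>0\<^esub> = M\<close>, spliced together; \<open>res_diff C r n\<close> is the
  differential \<open>P\<^bsub>n+1\<^esub> \<rightarrow> P\<^bsub>n\<^esub>\<close>.\<close>

definition E_projective_resolution ::
  "('o, 'm) cat \<Rightarrow> ('m \<times> 'm) set \<Rightarrow> 'o \<Rightarrow> (nat \<Rightarrow> 'm \<times> 'm) \<Rightarrow> bool" where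
  "E_projective_resolution C \<E> M r \<longleftrightarrow> tgt C (snd (r 0)) = M \<and>
     (\<forall>n. r n \<in> \<E> \<and> E_projective C \<E> (src C (snd (r n))) \<and>
          src C (fst (r n)) = tgt C (snd (r (Suc n))))"

definition res_obj :: "('o, 'm) cat \<Rightarrow> (nat \<Rightarrow> 'm \<times> 'm) \<Rightarrow> nat \<Rightarrow> 'o" where
  "res_obj C r n = src C (snd (r n))"

definition res_diff :: "('o, 'm) cat \<Rightarrow> (nat \<Rightarrow> 'm \<times> 'm) \<Rightarrow> nat \<Rightarrow> 'm" where
  "res_diff C r n = fst (r n) \<cdot>\<^bsub>C\<^esub> snd (r (Suc n))"

text \<open>The \<open>n\<close>-th cohomology group of \<open>Hom(P\<^bsub>*\<^esub>, N)\<close>, for \<open>n \<ge> 1\<close>.\<close>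

definition Ext_res :: "('o, 'm) cat \<Rightarrow> (nat \<Rightarrow> 'm \<times> 'm) \<Rightarrow> nat \<Rightarrow> 'o \<Rightarrow> 'm set monoid" where
  "Ext_res C r n N =
     (Mor_group C (res_obj C r n) N)
       \<lparr>carrier := kernel (Mor_group C (res_obj C r n) N) (Mor_group C (res_obj C r (n + 1)) N)
                     (\<lambda>f. f \<cdot>\<^bsub>C\<^esub> res_diff C r n)\<rparr>
     Mod ((\<lambda>f. f \<cdot>\<^bsub>C\<^esub> res_diff C r (n - 1)) ` Mor C (res_obj C r (n - 1)) N)"

text \<open>Up to isomorphism the group does not depend on the resolution, and a resolution exists
  whenever there are enough \<open>\<E>\<close>-projectives.\<close>

definition Ext :: "('o, 'm) cat \<Rightarrow> ('m \<times> 'm) set \<Rightarrow> nat \<Rightarrow> 'o \<Rightarrow> 'o \<Rightarrow> 'm set monoid" where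
  "Ext C \<E> n M N = Ext_res C (SOME r. E_projective_resolution C \<E> M r) n N"

definition right_perp :: "('o, 'm) cat \<Rightarrow> ('m \<times> 'm) set \<Rightarrow> 'o set \<Rightarrow> 'o set" where
  "right_perp C \<E> X = {N \<in> Ob C. \<forall>M \<in> X. trivial_group (Ext C \<E> 1 M N)}"

definition left_perp :: "('o, 'm) cat \<Rightarrow> ('m \<times> 'm) set \<Rightarrow> 'o set \<Rightarrow> 'o set" where
  "left_perp C \<E> Y = {M \<in> Ob C. \<forall>N \<in> Y. trivial_group (Ext C \<E> 1 M N)}"

text \<open>A full subcategory is represented by its set of objects.\<close>

definition subcategory :: "('o, 'm) cat \<Rightarrow> 'o set \<Rightarrow> bool" where
  "subcategory C T \<longleftrightarrow> T \<subseteq> Ob C \<and>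
     (\<exists>Z \<in> T. is_zero_object C Z) \<and>
     (\<forall>A \<in> T. \<forall>B \<in> T. \<forall>S. is_biproduct C A B S \<longrightarrow> S \<in> T) \<and>
     (\<forall>f. is_iso C f \<and> src C f \<in> T \<longrightarrow> tgt C f \<in> T) \<and>
     (\<forall>A B S. is_biproduct C A B S \<and> S \<in> T \<longrightarrow> A \<in> T)"

definition closed_under_E_extensions ::
  "('o, 'm) cat \<Rightarrow> ('m \<times> 'm) set \<Rightarrow> 'o set \<Rightarrow> bool" where
  "closed_under_E_extensions C \<E> T \<longleftrightarrow>
     (\<forall>(i, p) \<in> \<E>. src C i \<in> T \<and> tgt C p \<in> T \<longrightarrow> tgt C i \<in> T)"

definition E_resolving :: "('o, 'm) cat \<Rightarrow> ('m \<times> 'm) set \<Rightarrow> 'o set \<Rightarrow> bool" where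
  "E_resolving C \<E> T \<longleftrightarrow> (\<forall>P. E_projective C \<E> P \<longrightarrow> P \<in> T) \<and>
     closed_under_E_extensions C \<E> T \<and>
     (\<forall>(i, p) \<in> \<E>. tgt C i \<in> T \<and> tgt C p \<in> T \<longrightarrow> src C i \<in> T)"

definition E_coresolving :: "('o, 'm) cat \<Rightarrow> ('m \<times> 'm) set \<Rightarrow> 'o set \<Rightarrow> bool" where
  "E_coresolving C \<E> T \<longleftrightarrow> (\<forall>I. E_injective C \<E> I \<longrightarrow> I \<in> T) \<and>
     closed_under_E_extensions C \<E> T \<and>
     (\<forall>(i, p) \<in> \<E>. src C i \<in> T \<and> tgt C i \<in> T \<longrightarrow> tgt C p \<in> T)"

definition E_cotorsion_pair :: "('o, 'm) cat \<Rightarrow> ('m \<times> 'm) set \<Rightarrow> 'o set \<Rightarrow> 'o set \<Rightarrow> bool" where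
  "E_cotorsion_pair C \<E> X Y \<longleftrightarrow> X = left_perp C \<E> Y \<and> Y = right_perp C \<E> X"

definition complete_pair :: "('o, 'm) cat \<Rightarrow> ('m \<times> 'm) set \<Rightarrow> 'o set \<Rightarrow> 'o set \<Rightarrow> bool" where
  "complete_pair C \<E> X Y \<longleftrightarrow> (\<forall>M \<in> Ob C.
     (\<exists>(i, p) \<in> \<E>. src C i \<in> Y \<and> tgt C i \<in> X \<and> tgt C p = M) \<and>
     (\<exists>(i, p) \<in> \<E>. src C i = M \<and> tgt C i \<in> Y \<and> tgt C p \<in> X))"

definition hereditary_pair :: "('o, 'm) cat \<Rightarrow> ('m \<times> 'm) set \<Rightarrow> 'o set \<Rightarrow> 'o set \<Rightarrow> bool" where
  "hereditary_pair C \<E> X Y \<longleftrightarrow> E_resolving C \<E> X"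

definition is_precover :: "('o, 'm) cat \<Rightarrow> 'o set \<Rightarrow> 'o \<Rightarrow> 'm \<Rightarrow> bool" where
  "is_precover C X A p \<longleftrightarrow> p \<in> Ar C \<and> src C p \<in> X \<and> tgt C p = A \<and>
     (\<forall>X' \<in> X. \<forall>f \<in> Mor C X' A. \<exists>g \<in> Mor C X' (src C p). p \<cdot>\<^bsub>C\<^esub> g = f)"

definition is_preenvelope :: "('o, 'm) cat \<Rightarrow> 'o set \<Rightarrow> 'o \<Rightarrow> 'm \<Rightarrow> bool" where
  "is_preenvelope C Y A j \<longleftrightarrow> j \<in> Ar C \<and> src C j = A \<and> tgt C j \<in> Y \<and>
     (\<forall>Y' \<in> Y. \<forall>f \<in> Mor C A Y'. \<exists>g \<in> Mor C (tgt C j) Y'. g \<cdot>\<^bsub>C\<^esub> j = f)"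

end

theory Submission
  imports Defs
begin

text \<open>\<open>\<E>xt\<^sup>1(M, N)\<close> vanishes iff every conflation \<open>N \<rightarrow> L \<rightarrow> M\<close> splits, a condition that is
  self-dual; hence everything about (2) follows from (1) in the opposite category.
  An epimorphic \<open>\<X>\<close>-precover of \<open>A\<close> is an admissible epic since an \<open>\<E>\<close>-projective admissible epic
  onto \<open>A\<close> factors through it. Thus (1) provides special precovers, which give \<open>\<X> = left_perp \<Y>\<close>
  by splitting and, by Salce's trick, special preenvelopes. Finally, \<open>\<X>\<close> is resolving iff \<open>\<Y>\<close> is
  coresolving, by dimension shifting along \<open>K \<rightarrow> P \<rightarrow> M\<close> with \<open>P\<close> \<open>\<E>\<close>-projective.\<close>

section \<open>Additive and abelian preliminaries\<close>

text \<open>\<open>Ext\<close> is computed from one chosen projective resolution, so its dual would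
  be a computation with injective coresolutions, and comparing the two means proving that they are
  balanced. Translating the vanishing of Ext^1 into splitting removes this asymmetry: reversing
  arrows only exchanges sections with retractions, and each dual lemma is the original one
  instantiated at \<open>op_cat C\<close> and the converse of \<open>\<E>\<close>. Long exact
  sequences are likewise replaced by lifting and extending morphisms along a projective presentation
  K -> P -> M. The delicate point is admissibility: an epimorphic precover is only an epimorphism of
  the abelian category, while orthogonality speaks about conflations. Normality makes the precover a
  cokernel of its kernel, and this is what allows the comparison with a genuine pushout conflation.
  The definition of hereditary mentions X alone. Hence (1) leads to (3) directly, while (2) yields Y
  coresolving and requires the exchange between the two closure conditions.\<close>

context category
begin

lemma Ar_Mor: "f \<in> Ar C \<Longrightarrow> f \<in> Mor C (src C f) (tgt C f)"
  by (simp add: Mor_def)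

lemma Mor_Ob: "f \<in> Mor C A B \<Longrightarrow> A \<in> Ob C \<and> B \<in> Ob C"
  using src_Ob tgt_Ob by (auto simp: Mor_def)

lemma is_iso_ident: "A \<in> Ob C \<Longrightarrow> is_iso C (ident C A)"
  using ident_Mor[of A] cmp_ident_left[of "ident C A" A A] by (auto simp: is_iso_def Mor_def)

lemma is_isoE:
  assumes "is_iso C f" "f \<in> Mor C A B"
  obtains g where "is_iso C g" "g \<in> Mor C B A" "g \<cdot> f = ident C A" "f \<cdot> g = ident C B"
  using assms by (auto simp: is_iso_def Mor_def)

lemma is_monoD:
  assumes "is_mono C f" "f \<in> Mor C A B" "g \<in> Mor C T A" "h \<in> Mor C T A" "f \<cdot> g = f \<cdot> h"
  shows "g = h"
  using assms Mor_Ob[OF assms(3)] by (auto simp: is_mono_def Mor_def)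

lemma is_epiD:
  assumes "is_epi C f" "f \<in> Mor C A B" "g \<in> Mor C B T" "h \<in> Mor C B T" "g \<cdot> f = h \<cdot> f"
  shows "g = h"
  using assms Mor_Ob[OF assms(3)] by (auto simp: is_epi_def Mor_def)

lemma is_monoI:
  assumes "f \<in> Mor C A B"
    and "\<And>T g h. g \<in> Mor C T A \<Longrightarrow> h \<in> Mor C T A \<Longrightarrow> f \<cdot> g = f \<cdot> h \<Longrightarrow> g = h"
  shows "is_mono C f"
  using assms by (auto simp: is_mono_def Mor_def)

text \<open>The inverses of the three isomorphisms satisfy the reversed squares. In the opposite
  category an isomorphism of pairs runs backwards, whereas \<open>conflation_iso\<close> transports
  in one direction only; this lemma turns it round.\<close>

lemma pair_iso_sym:
  assumes "pair_iso C (i, p) (i', p')" and Ar: "i \<in> Ar C" "p \<in> Ar C" "tgt C i = src C p"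
    "i' \<in> Ar C" "p' \<in> Ar C" "tgt C i' = src C p'"
  shows "pair_iso C (i', p') (i, p)"
proof -
  obtain L M N L' M' N' where i: "i \<in> Mor C L M" "p \<in> Mor C M N"
    and i': "i' \<in> Mor C L' M'" "p' \<in> Mor C M' N'"
    using Ar Ar_Mor by metis
  obtain a b c where abc: "is_iso C a" "is_iso C b" "is_iso C c"
    "a \<in> Mor C L L'" "b \<in> Mor C M M'" "c \<in> Mor C N N'"
    and sq: "b \<cdot> i = i' \<cdot> a" "c \<cdot> p = p' \<cdot> b"
    using assms(1) i i' by (auto simp: pair_iso_def Mor_def)
  obtain a' where a': "is_iso C a'" "a' \<in> Mor C L' L" "a' \<cdot> a = ident C L" "a \<cdot> a' = ident C L'"
    using abc is_isoE by metis
  obtain b' where b': "is_iso C b'" "b' \<in> Mor C M' M" "b' \<cdot> b = ident C M" "b \<cdot> b' = ident C M'"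
    using abc is_isoE by metis
  obtain c' where c': "is_iso C c'" "c' \<in> Mor C N' N" "c' \<cdot> c = ident C N" "c \<cdot> c' = ident C N'"
    using abc is_isoE by metis
  have ia: "i \<cdot> a' \<in> Mor C L' M" and pb: "p \<cdot> b' \<in> Mor C M' N"
    using cmp_Mor[OF a'(2) i(1)] cmp_Mor[OF b'(2) i(2)] .
  have "i' = i' \<cdot> (a \<cdot> a')"
    using a'(4) cmp_ident_right[OF i'(1)] by simp
  also have "\<dots> = b \<cdot> (i \<cdot> a')"
    using cmp_assoc[OF a'(2) abc(4) i'(1)] cmp_assoc[OF a'(2) i(1) abc(5)] sq by simp
  finally have "b' \<cdot> i' = i \<cdot> a'"
    using cmp_assoc[OF ia abc(5) b'(2)] b'(3) cmp_ident_left[OF ia] by simp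
  moreover have "p' = p' \<cdot> (b \<cdot> b')"
    using b'(4) cmp_ident_right[OF i'(2)] by simp
  then have "p' = c \<cdot> (p \<cdot> b')"
    using cmp_assoc[OF b'(2) abc(5) i'(2)] cmp_assoc[OF b'(2) i(2) abc(6)] sq by simp
  then have "c' \<cdot> p' = p \<cdot> b'"
    using cmp_assoc[OF pb abc(6) c'(2)] c'(3) cmp_ident_left[OF pb] by simp
  moreover have "src C i = L" "tgt C i = M" "src C i' = L'" "tgt C i' = M'" "tgt C p = N" "tgt C p' = N'"
    using i i' by (auto simp: Mor_def)
  ultimately show ?thesis
    unfolding pair_iso_def prod.case using a'(1,2) b'(1,2) c'(1,2) by metis
qed

end

section \<open>Zero morphisms, differences, kernels and cokernels\<close>

context preadditive_category
begin

lemma zero_Mor: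
  assumes "A \<in> Ob C" "B \<in> Ob C"
  shows "zero_ar C A B \<in> Mor C A B"
proof -
  interpret comm_group "Mor_group C A B" using assms Mor_comm_group by blast
  show ?thesis using one_closed by (simp add: Mor_group_def)
qed

lemma plus_Mor:
  assumes "f \<in> Mor C A B" "g \<in> Mor C A B"
  shows "plus_ar C f g \<in> Mor C A B"
proof -
  interpret comm_group "Mor_group C A B" using assms Mor_Ob Mor_comm_group by blast
  show ?thesis using m_closed[of f g] assms by (simp add: Mor_group_def)
qed

lemma plus_zero:
  assumes "f \<in> Mor C A B"
  shows "plus_ar C f (zero_ar C A B) = f" "plus_ar C (zero_ar C A B) f = f"
proof -
  interpret comm_group "Mor_group C A B" using assms Mor_Ob Mor_comm_group by blast
  show "plus_ar C f (zero_ar C A B) = f" "plus_ar C (zero_ar C A B) f = f"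
    using r_one[of f] l_one[of f] assms by (auto simp: Mor_group_def)
qed

lemma plus_commute:
  assumes "f \<in> Mor C A B" "g \<in> Mor C A B"
  shows "plus_ar C f g = plus_ar C g f"
proof -
  interpret comm_group "Mor_group C A B" using assms Mor_Ob Mor_comm_group by blast
  show ?thesis using m_comm[of f g] assms by (auto simp: Mor_group_def)
qed

lemma plus_eq_self:
  assumes "d \<in> Mor C A B" "g \<in> Mor C A B" "plus_ar C d g = g"
  shows "d = zero_ar C A B"
proof -
  interpret comm_group "Mor_group C A B" using assms Mor_Ob Mor_comm_group by blast
  show ?thesis using l_cancel_one'[of g d] r_cancel_one'[of g d] assms by (auto simp: Mor_group_def)
qed

text \<open>The record \<open>cat\<close> has no subtraction, so f - g is always handled as a
  morphism d with f = d + g.\<close>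

lemma diff_ex:
  assumes "f \<in> Mor C A B" "g \<in> Mor C A B"
  shows "\<exists>d \<in> Mor C A B. f = plus_ar C d g"
proof -
  interpret comm_group "Mor_group C A B" using assms Mor_Ob Mor_comm_group by blast
  let ?G = "Mor_group C A B"
  have fg: "f \<in> carrier ?G" "g \<in> carrier ?G" using assms by (auto simp: Mor_group_def)
  then have "f = (f \<otimes>\<^bsub>?G\<^esub> inv\<^bsub>?G\<^esub> g) \<otimes>\<^bsub>?G\<^esub> g" by (simp add: m_assoc)
  moreover have "f \<otimes>\<^bsub>?G\<^esub> inv\<^bsub>?G\<^esub> g \<in> carrier ?G" using fg by simp
  ultimately show ?thesis by (auto simp: Mor_group_def)
qed

lemma cmp_zero_right:
  assumes "g \<in> Mor C B D" "A \<in> Ob C"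
  shows "g \<cdot> zero_ar C A B = zero_ar C A D"
proof -
  let ?z = "zero_ar C A B"
  have z: "?z \<in> Mor C A B" using assms zero_Mor Mor_Ob by blast
  have "plus_ar C (g \<cdot> ?z) (g \<cdot> ?z) = g \<cdot> plus_ar C ?z ?z"
    using cmp_plus_right[OF z z assms(1)] by simp
  then have "plus_ar C (g \<cdot> ?z) (g \<cdot> ?z) = g \<cdot> ?z" using plus_zero[OF z] by simp
  then show ?thesis using plus_eq_self cmp_Mor[OF z assms(1)] by blast
qed

lemma cmp_zero_left:
  assumes "f \<in> Mor C A B" "D \<in> Ob C"
  shows "zero_ar C B D \<cdot> f = zero_ar C A D"
proof -
  let ?z = "zero_ar C B D"
  have z: "?z \<in> Mor C B D" using assms zero_Mor Mor_Ob by blast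
  have "plus_ar C (?z \<cdot> f) (?z \<cdot> f) = plus_ar C ?z ?z \<cdot> f"
    using cmp_plus_left[OF assms(1) z z] by simp
  then have "plus_ar C (?z \<cdot> f) (?z \<cdot> f) = ?z \<cdot> f" using plus_zero[OF z] by simp
  then show ?thesis using plus_eq_self cmp_Mor[OF assms(1) z] by blast
qed

lemma is_kernel_zero:
  assumes "is_kernel C i p" "i \<in> Mor C L M" "p \<in> Mor C M N"
  shows "p \<cdot> i = zero_ar C L N"
  using assms by (auto simp: is_kernel_def Mor_def)

lemma is_kernel_factor:
  assumes "is_kernel C i p" "i \<in> Mor C L M" "p \<in> Mor C M N" "f \<in> Mor C T M"
    "p \<cdot> f = zero_ar C T N"
  shows "\<exists>g \<in> Mor C T L. i \<cdot> g = f"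
proof -
  have "src C i = L" "src C p = M" "tgt C p = N" "T \<in> Ob C"
    using assms Mor_Ob by (auto simp: Mor_def)
  then show ?thesis using assms(1,4,5) unfolding is_kernel_def by metis
qed

lemma is_kernel_mono:
  assumes "is_kernel C i p"
  shows "is_mono C i"
proof (rule is_monoI)
  show i: "i \<in> Mor C (src C i) (tgt C i)" using assms by (simp add: is_kernel_def Mor_def)
  have p: "p \<in> Mor C (tgt C i) (tgt C p)" using assms by (simp add: is_kernel_def Mor_def)
  fix T g h assume gh: "g \<in> Mor C T (src C i)" "h \<in> Mor C T (src C i)" "i \<cdot> g = i \<cdot> h"
  have T: "T \<in> Ob C" using gh Mor_Ob by blast
  have ig: "i \<cdot> g \<in> Mor C T (tgt C i)" using gh i cmp_Mor by blast
  have "p \<cdot> (i \<cdot> g) = (p \<cdot> i) \<cdot> g" using cmp_assoc[OF gh(1) i p] .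
  also have "\<dots> = zero_ar C T (tgt C p)"
    using is_kernel_zero[OF assms i p] cmp_zero_left[OF gh(1)] Mor_Ob[OF p] by simp
  finally have "p \<cdot> (i \<cdot> g) = zero_ar C T (tgt C p)" .
  then have "\<exists>!k. k \<in> Mor C T (src C i) \<and> i \<cdot> k = i \<cdot> g"
    using assms T ig unfolding is_kernel_def by auto
  then show "g = h" using gh by metis
qed

lemma is_cokernelI:
  assumes "i \<in> Mor C L M" "p \<in> Mor C M N" "p \<cdot> i = zero_ar C L N" "is_epi C p"
    and "\<And>T f. f \<in> Mor C M T \<Longrightarrow> f \<cdot> i = zero_ar C L T \<Longrightarrow> \<exists>g \<in> Mor C N T. g \<cdot> p = f"
  shows "is_cokernel C p i"
  unfolding is_cokernel_def
proof (intro conjI ballI impI)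
  fix T f assume T: "T \<in> Ob C" "f \<in> Mor C (tgt C i) T" "f \<cdot> i = zero_ar C (src C i) T"
  have "src C i = L" "tgt C i = M" "tgt C p = N" using assms by (auto simp: Mor_def)
  then have "\<exists>g \<in> Mor C N T. g \<cdot> p = f" using assms(5) T by auto
  then show "\<exists>!g. g \<in> Mor C (tgt C p) T \<and> g \<cdot> p = f"
    using is_epiD[OF assms(4,2)] \<open>tgt C p = N\<close> by metis
qed (use assms in \<open>auto simp: Mor_def\<close>)

lemma is_monoI_zero:
  assumes f: "f \<in> Mor C A B"
    and ker: "\<And>T g. g \<in> Mor C T A \<Longrightarrow> f \<cdot> g = zero_ar C T B \<Longrightarrow> g = zero_ar C T A"
  shows "is_mono C f"
proof (rule is_monoI[OF f])
  fix T g h assume gh: "g \<in> Mor C T A" "h \<in> Mor C T A" "f \<cdot> g = f \<cdot> h"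
  obtain d where d: "d \<in> Mor C T A" "g = plus_ar C d h" using diff_ex gh by blast
  have "plus_ar C (f \<cdot> d) (f \<cdot> h) = f \<cdot> h" using cmp_plus_right[OF d(1) gh(2) f] d(2) gh(3) by simp
  then have "f \<cdot> d = zero_ar C T B" using plus_eq_self cmp_Mor f d(1) gh(2) by blast
  then have "d = zero_ar C T A" using ker d by blast
  then show "g = h" using d plus_zero gh by simp
qed

end

section \<open>Duality\<close>

text \<open>Objects and arrows stay literally the same and only the operations change, so dual
  notions reduce to the original ones by rewriting. A class of conflations is dualised by taking its
  converse as a relation.\<close>

definition op_cat :: "('o, 'm) cat \<Rightarrow> ('o, 'm) cat" where
  "op_cat C = \<lparr>Ob = Ob C, Ar = Ar C, src = tgt C, tgt = src C, ident = ident C,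
     cmp = (\<lambda>f g. g \<cdot>\<^bsub>C\<^esub> f), zero_ar = (\<lambda>A B. zero_ar C B A), plus_ar = plus_ar C\<rparr>"

lemma op_cat_simps [simp]:
  "Ob (op_cat C) = Ob C" "Ar (op_cat C) = Ar C" "src (op_cat C) = tgt C" "tgt (op_cat C) = src C"
  "ident (op_cat C) = ident C" "f \<cdot>\<^bsub>op_cat C\<^esub> g = g \<cdot>\<^bsub>C\<^esub> f"
  "zero_ar (op_cat C) A B = zero_ar C B A" "plus_ar (op_cat C) = plus_ar C"
  by (simp_all add: op_cat_def)

lemma op_Mor [simp]: "Mor (op_cat C) A B = Mor C B A"
  by (auto simp: Mor_def)

lemma op_Mor_group [simp]: "Mor_group (op_cat C) A B = Mor_group C B A"
  by (simp add: Mor_group_def)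

lemma op_is_iso [simp]: "is_iso (op_cat C) f = is_iso C f"
  by (auto simp: is_iso_def)

lemma op_is_mono [simp]: "is_mono (op_cat C) f = is_epi C f"
  by (auto simp: is_mono_def is_epi_def)

lemma op_is_epi [simp]: "is_epi (op_cat C) f = is_mono C f"
  by (auto simp: is_mono_def is_epi_def)

lemma op_is_zero_object [simp]: "is_zero_object (op_cat C) Z = is_zero_object C Z"
  by (auto simp: is_zero_object_def)

lemma op_is_biproduct [simp]: "is_biproduct (op_cat C) A B S = is_biproduct C A B S"
  by (auto simp: is_biproduct_def)

lemma op_is_kernel [simp]: "is_kernel (op_cat C) f g = is_cokernel C f g"
  by (simp add: is_kernel_def is_cokernel_def conj_left_commute eq_commute)

lemma op_is_cokernel [simp]: "is_cokernel (op_cat C) f g = is_kernel C f g"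
  by (simp add: is_kernel_def is_cokernel_def conj_left_commute eq_commute)

lemma op_is_pullback [simp]: "is_pullback (op_cat C) f g q q' = is_pushout C f g q q'"
  by (simp add: is_pullback_def is_pushout_def)

lemma op_is_pushout [simp]: "is_pushout (op_cat C) f g q q' = is_pullback C f g q q'"
  by (simp add: is_pullback_def is_pushout_def)

lemma op_pair_iso: "pair_iso (op_cat C) (p, i) (p', i') \<Longrightarrow>
    src C p = tgt C i \<Longrightarrow> src C p' = tgt C i' \<Longrightarrow> pair_iso C (i', p') (i, p)"
  unfolding pair_iso_def prod.case op_cat_simps op_Mor op_is_iso
  by (elim exE conjE, intro exI conjI) (assumption | simp)+

lemma converse_adm_monic [simp]: "adm_monic (\<E>\<inverse>) = adm_epic \<E>"
  by (auto simp: adm_monic_def adm_epic_def)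

lemma converse_adm_epic [simp]: "adm_epic (\<E>\<inverse>) = adm_monic \<E>"
  by (auto simp: adm_monic_def adm_epic_def)

lemma op_E_projective [simp]: "E_projective (op_cat C) (\<E>\<inverse>) P = E_injective C \<E> P"
  by (auto simp: E_projective_def E_injective_def)

lemma op_E_injective [simp]: "E_injective (op_cat C) (\<E>\<inverse>) I = E_projective C \<E> I"
  by (auto simp: E_projective_def E_injective_def)

lemma op_enough_E_projectives [simp]:
  "enough_E_projectives (op_cat C) (\<E>\<inverse>) = enough_E_injectives C \<E>"
  by (auto simp: enough_E_projectives_def enough_E_injectives_def)

lemma op_enough_E_injectives [simp]:
  "enough_E_injectives (op_cat C) (\<E>\<inverse>) = enough_E_projectives C \<E>"
  by (auto simp: enough_E_projectives_def enough_E_injectives_def)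

lemma op_is_precover [simp]: "is_precover (op_cat C) X A p = is_preenvelope C X A p"
  by (auto simp: is_precover_def is_preenvelope_def)

lemma (in category) op_category: "category (op_cat C)"
  by unfold_locales
    (auto simp: src_Ob tgt_Ob ident_Mor cmp_Mor cmp_ident_left cmp_ident_right cmp_assoc)

lemma (in preadditive_category) op_preadditive_category: "preadditive_category (op_cat C)"
  by (intro preadditive_category.intro op_category preadditive_category_axioms.intro)
    (auto simp: Mor_comm_group cmp_plus_left cmp_plus_right)

lemma (in abelian_category) op_abelian_category: "abelian_category (op_cat C)"
  by (intro abelian_category.intro op_preadditive_category abelian_category_axioms.intro)
    (auto simp: zero_object biproduct kernel cokernel mono_normal epi_normal)

text \<open>The axioms come in dual couples: admissible monics swap with admissible epics and
  pushouts with pullbacks. Only closure under isomorphism is a single axiom; there the reversed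
  isomorphism of pairs has to be inverted.\<close>

lemma (in exact_structure) op_exact_structure: "exact_structure (op_cat C) (\<E>\<inverse>)"
proof (intro exact_structure.intro op_abelian_category exact_structure_axioms.intro)
  fix i p i' p'
  assume E: "(i, p) \<in> \<E>\<inverse>" and Ar: "i' \<in> Ar (op_cat C)" "p' \<in> Ar (op_cat C)"
    "tgt (op_cat C) i' = src (op_cat C) p'"
    and iso: "pair_iso (op_cat C) (i, p) (i', p')"
  have pi: "p \<in> Ar C" "i \<in> Ar C" "tgt C p = src C i"
    using conflation_pair E by (auto simp: kernel_cokernel_pair_def is_kernel_def)
  have "pair_iso C (p', i') (p, i)" using op_pair_iso[OF iso] pi Ar by simp
  then have "pair_iso C (p, i) (p', i')" using pair_iso_sym pi Ar by auto
  then show "(i', p') \<in> \<E>\<inverse>" using conflation_iso E Ar by auto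
qed (auto simp: kernel_cokernel_pair_def
    ident_adm_monic ident_adm_epic cmp_adm_monic cmp_adm_epic pullback_adm_epic pushout_adm_monic
    pullback_ex pushout_ex dest: conflation_pair)

section \<open>Conflations\<close>

text \<open>Naming the three objects replaces side conditions on \<open>src\<close> and
  \<open>tgt\<close> by parameters, which duality merely permutes.\<close>

definition conflation ::
  "('o, 'm) cat \<Rightarrow> ('m \<times> 'm) set \<Rightarrow> 'o \<Rightarrow> 'o \<Rightarrow> 'o \<Rightarrow> 'm \<Rightarrow> 'm \<Rightarrow> bool" where
  "conflation C \<E> L M N i p \<longleftrightarrow> (i, p) \<in> \<E> \<and> i \<in> Mor C L M \<and> p \<in> Mor C M N"

lemma op_conflation [simp]: "conflation (op_cat C) (\<E>\<inverse>) N M L p i = conflation C \<E> L M N i p"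
  by (auto simp: conflation_def)

lemma (in preadditive_category) is_kernelI:
  assumes "i \<in> Mor C L M" "p \<in> Mor C M N" "p \<cdot> i = zero_ar C L N" "is_mono C i"
    and "\<And>T f. f \<in> Mor C T M \<Longrightarrow> p \<cdot> f = zero_ar C T N \<Longrightarrow> \<exists>g \<in> Mor C T L. i \<cdot> g = f"
  shows "is_kernel C i p"
  using preadditive_category.is_cokernelI[OF op_preadditive_category, of p N M i L] assms by simp

lemma (in preadditive_category) is_cokernel_factor:
  assumes "is_cokernel C p i" "i \<in> Mor C L M" "p \<in> Mor C M N" "f \<in> Mor C M T"
    "f \<cdot> i = zero_ar C L T"
  shows "\<exists>g \<in> Mor C N T. g \<cdot> p = f"
  using preadditive_category.is_kernel_factor[OF op_preadditive_category, of p i N M L f T] assms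
  by simp

lemma (in preadditive_category) is_cokernel_epi: "is_cokernel C p i \<Longrightarrow> is_epi C p"
  using preadditive_category.is_kernel_mono[OF op_preadditive_category, of p i] by simp

lemma (in preadditive_category) is_epiI_zero:
  assumes "f \<in> Mor C A B"
    and "\<And>T g. g \<in> Mor C B T \<Longrightarrow> g \<cdot> f = zero_ar C A T \<Longrightarrow> g = zero_ar C B T"
  shows "is_epi C f"
  using preadditive_category.is_monoI_zero[OF op_preadditive_category, of f B A] assms by simp

text \<open>A monomorphism f is the kernel of some g, and f epi forces g = 0. Then the identity
  factors through f, and cancelling f on the left shows that this right inverse is
  two-sided.\<close>

lemma (in abelian_category) is_iso_mono_epi:
  assumes "is_mono C f" "is_epi C f"
  shows "is_iso C f"
proof -
  obtain g where g: "is_kernel C f g" using mono_normal assms by blast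
  define A B D where "A = src C f" and "B = tgt C f" and "D = tgt C g"
  have fm: "f \<in> Mor C A B" and gm: "g \<in> Mor C B D"
    using g by (auto simp: is_kernel_def Mor_def A_def B_def D_def)
  have Ob: "A \<in> Ob C" "B \<in> Ob C" "D \<in> Ob C" using fm gm Mor_Ob by auto
  have "g \<cdot> f = zero_ar C B D \<cdot> f"
    using is_kernel_zero[OF g fm gm] cmp_zero_left[OF fm] Ob by simp
  then have "g = zero_ar C B D" using is_epiD[OF assms(2) fm gm] zero_Mor Ob by blast
  then have "g \<cdot> ident C B = zero_ar C B D" using cmp_ident_right gm by simp
  then obtain h where h: "h \<in> Mor C B A" "f \<cdot> h = ident C B"
    using is_kernel_factor[OF g fm gm] ident_Mor Ob by blast
  have "f \<cdot> (h \<cdot> f) = f \<cdot> ident C A"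
    using cmp_assoc[OF fm h(1) fm] h(2) cmp_ident_left[OF fm] cmp_ident_right[OF fm] by simp
  then have "h \<cdot> f = ident C A"
    using is_monoD[OF assms(1) fm cmp_Mor[OF fm h(1)]] ident_Mor Ob by blast
  then show ?thesis using h fm by (auto simp: is_iso_def Mor_def)
qed

text \<open>By normality p is a cokernel of some h. Since h factors through k, every morphism that
  kills k kills h and so factors through p.\<close>

lemma (in abelian_category) is_cokernel_of_kernel:
  assumes p: "is_epi C p" and k: "is_kernel C k p"
  shows "is_cokernel C p k"
proof -
  obtain h where h: "is_cokernel C p h" using epi_normal p by blast
  define H K X A where "H = src C h" and "K = src C k" and "X = src C p" and "A = tgt C p"
  have hm: "h \<in> Mor C H X" and km: "k \<in> Mor C K X" and pm: "p \<in> Mor C X A"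
    using h k by (auto simp: is_kernel_def is_cokernel_def Mor_def H_def K_def X_def A_def)
  have "p \<cdot> h = zero_ar C H A"
    using h by (simp add: is_cokernel_def H_def A_def)
  then obtain h' where h': "h' \<in> Mor C H K" "k \<cdot> h' = h"
    using is_kernel_factor[OF k km pm hm] by blast
  show ?thesis
  proof (rule is_cokernelI[OF km pm is_kernel_zero[OF k km pm] p])
    fix T t assume t: "t \<in> Mor C X T" "t \<cdot> k = zero_ar C K T"
    have "t \<cdot> h = zero_ar C H T"
      using cmp_assoc[OF h'(1) km t(1)] h' t(2) cmp_zero_left[OF h'(1)] Mor_Ob[OF t(1)] by simp
    then show "\<exists>g \<in> Mor C A T. g \<cdot> p = t" using is_cokernel_factor[OF h hm pm t(1)] by blast
  qed
qed

lemma (in category) is_pushoutD: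
  assumes "is_pushout C f g q q'" "f \<in> Mor C L M" "g \<in> Mor C L L'"
    "q \<in> Mor C M M'" "q' \<in> Mor C L' M'"
    "u \<in> Mor C M T" "v \<in> Mor C L' T" "u \<cdot> f = v \<cdot> g"
  shows "\<exists>!w. w \<in> Mor C M' T \<and> w \<cdot> q = u \<and> w \<cdot> q' = v"
proof -
  have "tgt C f = M" "tgt C g = L'" "tgt C q = M'" "T \<in> Ob C"
    using assms(2-6) Mor_Ob by (auto simp: Mor_def)
  then show ?thesis using assms(1,6-8) unfolding is_pushout_def by blast
qed

section \<open>Conflations, their pushouts and pullbacks, and admissibility of epimorphisms\<close>

context exact_structure
begin

lemma conflation_Ob:
  assumes "conflation C \<E> L M N i p"
  shows "L \<in> Ob C" "M \<in> Ob C" "N \<in> Ob C"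
  using assms Mor_Ob unfolding conflation_def by blast+

lemma conflationD:
  assumes "conflation C \<E> L M N i p"
  shows conflation_in: "(i, p) \<in> \<E>"
    and conflation_inj: "i \<in> Mor C L M" and conflation_proj: "p \<in> Mor C M N"
    and conflation_is_kernel: "is_kernel C i p" and conflation_is_cokernel: "is_cokernel C p i"
    and conflation_zero: "p \<cdot> i = zero_ar C L N"
    and conflation_mono: "is_mono C i" and conflation_epi: "is_epi C p"
    and conflation_adm_monic: "adm_monic \<E> i" and conflation_adm_epic: "adm_epic \<E> p"
    and conflation_lift: "f \<in> Mor C T M \<Longrightarrow> p \<cdot> f = zero_ar C T N \<Longrightarrow> \<exists>g \<in> Mor C T L. i \<cdot> g = f"
    and conflation_extend: "f' \<in> Mor C M T \<Longrightarrow> f' \<cdot> i = zero_ar C L T \<Longrightarrow> \<exists>g \<in> Mor C N T. g \<cdot> p = f'"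
proof -
  show E: "(i, p) \<in> \<E>" and i: "i \<in> Mor C L M" and p: "p \<in> Mor C M N"
    using assms by (auto simp: conflation_def)
  show k: "is_kernel C i p" and c: "is_cokernel C p i"
    using conflation_pair[OF E] by (auto simp: kernel_cokernel_pair_def)
  show "p \<cdot> i = zero_ar C L N" "is_mono C i" "is_epi C p" "adm_monic \<E> i" "adm_epic \<E> p"
    using is_kernel_zero[OF k i p] is_kernel_mono[OF k] is_cokernel_epi[OF c] E
    by (auto simp: adm_monic_def adm_epic_def)
  show "f \<in> Mor C T M \<Longrightarrow> p \<cdot> f = zero_ar C T N \<Longrightarrow> \<exists>g \<in> Mor C T L. i \<cdot> g = f"
    using is_kernel_factor[OF k i p] .
  show "f' \<in> Mor C M T \<Longrightarrow> f' \<cdot> i = zero_ar C L T \<Longrightarrow> \<exists>g \<in> Mor C N T. g \<cdot> p = f'"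
    using is_cokernel_factor[OF c i p] .
qed

lemma conflationI:
  assumes "(i, p) \<in> \<E>"
  shows "conflation C \<E> (src C i) (tgt C i) (tgt C p) i p"
  using conflation_pair[OF assms] assms
  by (auto simp: conflation_def kernel_cokernel_pair_def is_kernel_def Mor_def)

lemma conflation_iff: "conflation C \<E> L M N i p \<longleftrightarrow> (i, p) \<in> \<E> \<and> L = src C i \<and> M = tgt C i \<and> N = tgt C p"
  using conflationI by (auto simp: conflation_def Mor_def)

lemma conflation_iso_ident:
  assumes c: "conflation C \<E> L M N i p" and b: "is_iso C b" "b \<in> Mor C M M'"
    and i': "i' \<in> Mor C L M'" and p': "p' \<in> Mor C M' N" and eq: "b \<cdot> i = i'" "p' \<cdot> b = p"
  shows "conflation C \<E> L M' N i' p'"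
proof -
  note D = conflationD[OF c] and O = conflation_Ob[OF c]
  have "src C i = L" "tgt C i = M" "src C i' = L" "tgt C i' = M'" "tgt C p = N" "tgt C p' = N"
    using D(2,3) i' p' by (auto simp: Mor_def)
  moreover have "b \<cdot> i = i' \<cdot> ident C L" "ident C N \<cdot> p = p' \<cdot> b"
    using eq cmp_ident_right[OF i'] cmp_ident_left[OF D(3)] by auto
  ultimately have "pair_iso C (i, p) (i', p')"
    unfolding pair_iso_def prod.case using b is_iso_ident ident_Mor O by metis
  then show ?thesis using conflation_iso[OF D(1)] i' p' by (auto simp: conflation_def Mor_def)
qed

text \<open>An admissible monic has some partner q in \<open>\<E>\<close>. Both p and q are
  cokernels of i, hence isomorphic, and closure under isomorphism replaces q by p. This supplies the
  missing second arrow when an axiom asserts only that a monic is admissible.\<close>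

lemma conflation_of_cokernel:
  assumes "adm_monic \<E> i" "is_cokernel C p i"
  shows "conflation C \<E> (src C i) (tgt C i) (tgt C p) i p"
proof -
  obtain q where "(i, q) \<in> \<E>" using assms by (auto simp: adm_monic_def)
  define L M N N' where "L = src C i" and "M = tgt C i" and "N = tgt C p" and "N' = tgt C q"
  have c: "conflation C \<E> L M N' i q"
    using conflationI[OF \<open>(i, q) \<in> \<E>\<close>] by (simp add: L_def M_def N'_def)
  note D = conflationD[OF c]
  have p: "p \<in> Mor C M N"
    using assms by (auto simp: is_cokernel_def Mor_def M_def N_def)
  have pi: "p \<cdot> i = zero_ar C L N"
    using assms by (auto simp: is_cokernel_def L_def N_def)
  obtain c where c': "c \<in> Mor C N' N" "c \<cdot> q = p" using conflation_extend[OF c p pi] by blast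
  obtain d where d: "d \<in> Mor C N N'" "d \<cdot> p = q"
    using is_cokernel_factor[OF assms(2) D(2) p D(3)] D(6) by blast
  have Ob: "N \<in> Ob C" "N' \<in> Ob C" "L \<in> Ob C" "M \<in> Ob C"
    using p D(2,3) Mor_Ob by auto
  have "(d \<cdot> c) \<cdot> q = ident C N' \<cdot> q"
    using cmp_assoc[OF D(3) c'(1) d(1)] c'(2) d(2) cmp_ident_left[OF D(3)] by simp
  then have dc: "d \<cdot> c = ident C N'"
    using is_epiD[OF D(8) D(3) cmp_Mor[OF c'(1) d(1)]] ident_Mor Ob by blast
  have "(c \<cdot> d) \<cdot> p = ident C N \<cdot> p"
    using cmp_assoc[OF p d(1) c'(1)] c'(2) d(2) cmp_ident_left[OF p] by simp
  then have cd: "c \<cdot> d = ident C N"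
    using is_epiD[OF is_cokernel_epi[OF assms(2)] p cmp_Mor[OF d(1) c'(1)]] ident_Mor Ob by blast
  have "is_iso C c" using c' d dc cd by (auto simp: is_iso_def Mor_def)
  moreover have "ident C M \<cdot> i = i \<cdot> ident C L" "c \<cdot> q = p \<cdot> ident C M"
    using cmp_ident_left[OF D(2)] cmp_ident_right[OF D(2)] cmp_ident_right[OF p] c' by auto
  ultimately have "pair_iso C (i, q) (i, p)"
    unfolding pair_iso_def prod.case
    using is_iso_ident ident_Mor Ob c'(1) L_def M_def N_def N'_def by metis
  then have "(i, p) \<in> \<E>"
    using conflation_iso[OF D(1)] D(2) p by (auto simp: Mor_def)
  then show ?thesis by (rule conflationI)
qed

lemma conflation_of_kernel:
  assumes "adm_epic \<E> p" "is_kernel C i p"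
  shows "conflation C \<E> (src C i) (tgt C i) (tgt C p) i p"
proof -
  have "(i, p) \<in> \<E>"
    using exact_structure.conflation_of_cokernel[OF op_exact_structure, of p i] assms
    by (simp add: conflation_def)
  then show ?thesis by (rule conflationI)
qed

text \<open>Pushing out preserves the cokernel. The pair (p, 0) induces p'; a morphism t with t i' =
  0 gives t f' with (t f') i = 0, which factors through p, and uniqueness in the pushout carries the
  factorisation over to t.\<close>

lemma pushout_conflation:
  assumes c: "conflation C \<E> L M N i p" and f: "f \<in> Mor C L L'"
  shows "\<exists>M' i' f' p'. conflation C \<E> L' M' N i' p' \<and> f' \<in> Mor C M M' \<and>
    f' \<cdot> i = i' \<cdot> f \<and> p' \<cdot> f' = p \<and> is_pushout C i f f' i'"
proof -
  note D = conflationD[OF c] and O = conflation_Ob[OF c]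
  have s: "src C f = L" "tgt C f = L'" "src C i = L" "tgt C i = M" and fA: "f \<in> Ar C"
    using f D(2) by (auto simp: Mor_def)
  obtain f' i' where po: "is_pushout C i f f' i'"
    using pushout_ex[OF D(9) fA] s by auto
  define M' where "M' = tgt C f'"
  have f': "f' \<in> Mor C M M'" and i': "i' \<in> Mor C L' M'" and sq: "f' \<cdot> i = i' \<cdot> f"
    using po s by (auto simp: is_pushout_def Mor_def M'_def)
  note univ = is_pushoutD[OF po D(2) f f' i']
  have Ob: "L' \<in> Ob C" "M' \<in> Ob C" using f f' Mor_Ob by auto
  have "p \<cdot> i = zero_ar C L' N \<cdot> f" using cmp_zero_left[OF f] D(6) O by simp
  then obtain p' where p': "p' \<in> Mor C M' N" "p' \<cdot> f' = p" "p' \<cdot> i' = zero_ar C L' N"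
    using univ[OF D(3)] zero_Mor Ob O by blast
  have epi: "is_epi C p'"
  proof (rule is_epiI_zero[OF p'(1)])
    fix T g assume g: "g \<in> Mor C N T" "g \<cdot> p' = zero_ar C M' T"
    have T: "T \<in> Ob C" using g Mor_Ob by blast
    have "g \<cdot> p = zero_ar C N T \<cdot> p"
      using cmp_assoc[OF f' p'(1) g(1)] p'(2) g(2) cmp_zero_left[OF f'] cmp_zero_left[OF D(3)] T
      by simp
    then show "g = zero_ar C N T" using is_epiD[OF D(8) D(3) g(1)] zero_Mor O T by blast
  qed
  have "is_cokernel C p' i'"
  proof (rule is_cokernelI[OF i' p'(1) p'(3) epi])
    fix T t assume t: "t \<in> Mor C M' T" "t \<cdot> i' = zero_ar C L' T"
    have T: "T \<in> Ob C" using t Mor_Ob by blast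
    have tf: "t \<cdot> f' \<in> Mor C M T" using cmp_Mor[OF f' t(1)] .
    have tfi: "(t \<cdot> f') \<cdot> i = zero_ar C L' T \<cdot> f"
      using cmp_assoc[OF D(2) f' t(1)] cmp_assoc[OF f i' t(1)] sq t(2) by simp
    then have "(t \<cdot> f') \<cdot> i = zero_ar C L T" using cmp_zero_left[OF f T] by simp
    then obtain g where g: "g \<in> Mor C N T" "g \<cdot> p = t \<cdot> f'"
      using conflation_extend[OF c tf] by blast
    have "(g \<cdot> p') \<cdot> f' = t \<cdot> f'" "(g \<cdot> p') \<cdot> i' = zero_ar C L' T"
      using cmp_assoc[OF f' p'(1) g(1)] g(2) p'(2,3) cmp_assoc[OF i' p'(1) g(1)]
        cmp_zero_right[OF g(1) Ob(1)] by auto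
    then have "g \<cdot> p' = t"
      using univ[OF tf _ tfi] zero_Mor[OF Ob(1) T] t cmp_Mor[OF p'(1) g(1)] by blast
    then show "\<exists>g \<in> Mor C N T. g \<cdot> p' = t" using g by blast
  qed
  then have "conflation C \<E> L' M' N i' p'"
    using conflation_of_cokernel pushout_adm_monic[OF D(9) po] i' p'(1) by (auto simp: Mor_def)
  then show ?thesis using f' sq p' po by blast
qed

lemma pullback_conflation:
  assumes "conflation C \<E> L M N i p" "f \<in> Mor C N' N"
  shows "\<exists>M' i' f' p'. conflation C \<E> L M' N' i' p' \<and> f' \<in> Mor C M' M \<and>
    p \<cdot> f' = f \<cdot> p' \<and> f' \<cdot> i' = i \<and> is_pullback C p f f' p'"
  using exact_structure.pushout_conflation[OF op_exact_structure, of N M L p i f N'] assms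
  by auto

text \<open>A form of Quillen's obscure axiom. The conflation of \<open>p \<cdot> g\<close>, pushed out along
  the induced morphism to \<open>Ker p\<close>, is isomorphic to \<open>Ker p \<rightarrow> X \<rightarrow> A\<close> by the short five lemma.\<close>

lemma adm_epic_of_cmp:
  assumes c: "conflation C \<E> L P A i q" and g: "g \<in> Mor C P X" and p: "p \<in> Mor C X A"
    and epi: "is_epi C p" and pg: "p \<cdot> g = q" and k: "is_kernel C k p"
  shows "conflation C \<E> (src C k) X A k p"
proof -
  note D = conflationD[OF c] and O = conflation_Ob[OF c]
  define K where "K = src C k"
  have km: "k \<in> Mor C K X" using k p by (auto simp: is_kernel_def Mor_def K_def)
  have X: "X \<in> Ob C" "K \<in> Ob C" using km Mor_Ob by auto
  have pk: "p \<cdot> k = zero_ar C K A" using is_kernel_zero[OF k km p] .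
  have "p \<cdot> (g \<cdot> i) = zero_ar C L A" using cmp_assoc[OF D(2) g p] pg D(6) by simp
  then obtain l where l: "l \<in> Mor C L K" "k \<cdot> l = g \<cdot> i"
    using is_kernel_factor[OF k km p cmp_Mor[OF D(2) g]] by blast
  obtain E j g' r where e: "conflation C \<E> K E A j r" and g': "g' \<in> Mor C P E"
    and sq: "g' \<cdot> i = j \<cdot> l" and rg: "r \<cdot> g' = q"
    and po: "is_pushout C i l g' j"
    using pushout_conflation[OF c l(1)] by blast
  note D' = conflationD[OF e] and O' = conflation_Ob[OF e]
  note univ = is_pushoutD[OF po D(2) l(1) g' D'(2)]
  \<comment> \<open>The comparison b from the pushout to X is induced by g and k, which agree on L
    by the choice of l.\<close>
  obtain b where b: "b \<in> Mor C E X" "b \<cdot> j = k" "b \<cdot> g' = g"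
    using univ[OF g km] l(2) by metis
  have q0: "q \<cdot> i = zero_ar C K A \<cdot> l" using D(6) cmp_zero_left[OF l(1) O(3)] by simp
  have "(p \<cdot> b) \<cdot> g' = q" "(p \<cdot> b) \<cdot> j = zero_ar C K A"
    using cmp_assoc[OF g' b(1) p] cmp_assoc[OF D'(2) b(1) p] b pg pk by auto
  then have pb: "p \<cdot> b = r"
    using univ[OF D(3) zero_Mor[OF X(2) O(3)] q0] rg D'(3,6) cmp_Mor[OF b(1) p] by blast
  \<comment> \<open>First half of the short five lemma: b t = 0 gives r t = 0, so t = j s, and then
    k s = b t = 0 with k mono forces s = 0.\<close>
  have "is_mono C b"
  proof (rule is_monoI_zero[OF b(1)])
    fix T t assume t: "t \<in> Mor C T E" "b \<cdot> t = zero_ar C T X"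
    have T: "T \<in> Ob C" using t Mor_Ob by blast
    have "r \<cdot> t = zero_ar C T A"
      using cmp_assoc[OF t(1) b(1) p] pb t(2) cmp_zero_right[OF p T] by simp
    then obtain s where s: "s \<in> Mor C T K" "j \<cdot> s = t" using conflation_lift[OF e t(1)] by blast
    have "k \<cdot> s = k \<cdot> zero_ar C T K"
      using cmp_assoc[OF s(1) D'(2) b(1)] b(2) s(2) t(2) cmp_zero_right[OF km T] by simp
    then have "s = zero_ar C T K"
      using is_monoD[OF is_kernel_mono[OF k] km s(1)] zero_Mor T X by blast
    then show "t = zero_ar C T E" using s(2) cmp_zero_right[OF D'(2) T] by simp
  qed
  \<comment> \<open>Second half: t b = 0 gives t k = 0, so t factors through p, which is a cokernel
    of k by normality; the factor vanishes because r is epi.\<close>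
  moreover have "is_epi C b"
  proof (rule is_epiI_zero[OF b(1)])
    fix T t assume t: "t \<in> Mor C X T" "t \<cdot> b = zero_ar C E T"
    have T: "T \<in> Ob C" using t Mor_Ob by blast
    have "t \<cdot> k = zero_ar C K T"
      using cmp_assoc[OF D'(2) b(1) t(1)] b(2) t(2) cmp_zero_left[OF D'(2) T] by simp
    then obtain s where s: "s \<in> Mor C A T" "s \<cdot> p = t"
      using is_cokernel_factor[OF is_cokernel_of_kernel[OF epi k] km p t(1)] by blast
    have "s \<cdot> r = zero_ar C A T \<cdot> r"
      using cmp_assoc[OF b(1) p s(1)] pb s(2) t(2) cmp_zero_left[OF D'(3) T] by simp
    then have "s = zero_ar C A T"
      using is_epiD[OF D'(8) D'(3) s(1)] zero_Mor T O by blast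
    then show "t = zero_ar C X T" using s(2) cmp_zero_left[OF p T] by simp
  qed
  ultimately have "is_iso C b" by (rule is_iso_mono_epi)
  then show ?thesis using conflation_iso_ident[OF e _ b(1) km p b(2) pb] by (simp add: K_def)
qed

end
section \<open>Splitting of conflations and Ext\<close>

text \<open>The arguments are ordered as in Ext^1(M, N): N is the subobject and M the quotient.
  Testing by a section is an arbitrary choice of side; the retraction form is equivalent.\<close>

definition all_split :: "('o, 'm) cat \<Rightarrow> ('m \<times> 'm) set \<Rightarrow> 'o \<Rightarrow> 'o \<Rightarrow> bool" where
  "all_split C \<E> M N \<longleftrightarrow>
     (\<forall>L i p. conflation C \<E> N L M i p \<longrightarrow> (\<exists>s \<in> Mor C M L. p \<cdot>\<^bsub>C\<^esub> s = ident C M))"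

lemma all_splitD:
  assumes "all_split C \<E> M N" "conflation C \<E> N L M i p"
  shows "\<exists>s \<in> Mor C M L. p \<cdot>\<^bsub>C\<^esub> s = ident C M"
  using assms by (auto simp: all_split_def)

lemma (in category) is_pullbackD:
  assumes "is_pullback C f g q q'" "f \<in> Mor C M N" "g \<in> Mor C N' N"
    "q \<in> Mor C M' M" "q' \<in> Mor C M' N'"
    "u \<in> Mor C T M" "v \<in> Mor C T N'" "f \<cdot> u = g \<cdot> v"
  shows "\<exists>!w. w \<in> Mor C T M' \<and> q \<cdot> w = u \<and> q' \<cdot> w = v"
  using category.is_pushoutD[OF op_category, of f g q q' N M N' M' u T v] assms by simp

lemma (in category) is_pullback_swap: "is_pullback C f g q q' \<Longrightarrow> is_pullback C g f q' q"
  unfolding is_pullback_def by (elim conjE) (intro conjI ballI impI; simp add: conj_commute)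

section \<open>Sections, retractions, and the extension of morphisms along conflations\<close>

context exact_structure
begin

text \<open>The morphism 1 - s p is killed by p, hence equals i r for some r; the remaining
  equations follow by cancelling the monomorphism i.\<close>

lemma retraction_of_section:
  assumes c: "conflation C \<E> L M N i p" and s: "s \<in> Mor C N M" "p \<cdot> s = ident C N"
  shows "\<exists>r \<in> Mor C M L. r \<cdot> i = ident C L \<and> r \<cdot> s = zero_ar C N L \<and>
    plus_ar C (i \<cdot> r) (s \<cdot> p) = ident C M"
proof -
  note D = conflationD[OF c] and O = conflation_Ob[OF c]
  have sp: "s \<cdot> p \<in> Mor C M M" using cmp_Mor D s by blast
  \<comment> \<open>Here d stands for 1 - s p.\<close>
  obtain d where d: "d \<in> Mor C M M" "ident C M = plus_ar C d (s \<cdot> p)"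
    using diff_ex[OF ident_Mor sp] O by blast
  have psp: "p \<cdot> (s \<cdot> p) = p"
    using cmp_assoc[OF D(3) s(1) D(3)] s(2) cmp_ident_left[OF D(3)] by simp
  have "p = p \<cdot> plus_ar C d (s \<cdot> p)" using d(2) cmp_ident_right[OF D(3)] by simp
  then have "plus_ar C (p \<cdot> d) p = p" using cmp_plus_right[OF d(1) sp D(3)] psp by simp
  then have "p \<cdot> d = zero_ar C M N" using plus_eq_self[OF cmp_Mor[OF d(1) D(3)] D(3)] by simp
  then obtain r where r: "r \<in> Mor C M L" "i \<cdot> r = d" using conflation_lift[OF c d(1)] by blast
  have spi: "(s \<cdot> p) \<cdot> i = zero_ar C L M"
    using cmp_assoc[OF D(2,3) s(1)] D(6) cmp_zero_right[OF s(1) O(1)] by simp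
  have di: "d \<cdot> i \<in> Mor C L M" using cmp_Mor D(2) d by blast
  have "i = plus_ar C d (s \<cdot> p) \<cdot> i" using d(2) cmp_ident_left[OF D(2)] by simp
  also have "\<dots> = d \<cdot> i" using cmp_plus_left[OF D(2) d(1) sp] spi plus_zero[OF di] by simp
  finally have "i \<cdot> (r \<cdot> i) = i \<cdot> ident C L"
    using cmp_assoc[OF D(2) r(1) D(2)] r(2) cmp_ident_right[OF D(2)] by simp
  then have ri: "r \<cdot> i = ident C L"
    using is_monoD[OF D(7) D(2) cmp_Mor[OF D(2) r(1)]] ident_Mor O by blast
  have ds: "d \<cdot> s \<in> Mor C N M" using cmp_Mor s d by blast
  have "s = plus_ar C d (s \<cdot> p) \<cdot> s" using d(2) cmp_ident_left[OF s(1)] by simp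
  also have "\<dots> = plus_ar C (d \<cdot> s) s"
    using cmp_plus_left[OF s(1) d(1) sp] cmp_assoc[OF s(1) D(3) s(1)] s(2)
      cmp_ident_right[OF s(1)] by simp
  finally have "d \<cdot> s = zero_ar C N M" using plus_eq_self[OF ds s(1)] by simp
  then have "i \<cdot> (r \<cdot> s) = i \<cdot> zero_ar C N L"
    using cmp_assoc[OF s(1) r(1) D(2)] r(2) cmp_zero_right[OF D(2) O(3)] by simp
  then have "r \<cdot> s = zero_ar C N L"
    using is_monoD[OF D(7) D(2) cmp_Mor[OF s(1) r(1)]] zero_Mor O by blast
  then show ?thesis using r ri d(2) by auto
qed

lemma section_of_retraction:
  assumes "conflation C \<E> L M N i p" "r \<in> Mor C M L" "r \<cdot> i = ident C L"
  shows "\<exists>s \<in> Mor C N M. p \<cdot> s = ident C N"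
  using exact_structure.retraction_of_section[OF op_exact_structure, of N M L p i r] assms
  by auto

text \<open>The quotient N is listed first because \<open>subcategory\<close> states closure under
  direct summands for the first summand.\<close>

lemma is_biproduct_of_section:
  assumes c: "conflation C \<E> L M N i p" and s: "s \<in> Mor C N M" "p \<cdot> s = ident C N"
  shows "is_biproduct C N L M"
proof -
  note D = conflationD[OF c] and O = conflation_Ob[OF c]
  obtain r where r: "r \<in> Mor C M L" "r \<cdot> i = ident C L" "r \<cdot> s = zero_ar C N L"
    "plus_ar C (i \<cdot> r) (s \<cdot> p) = ident C M"
    using retraction_of_section[OF assms] by blast
  have "plus_ar C (s \<cdot> p) (i \<cdot> r) = ident C M"
    using plus_commute[OF cmp_Mor[OF D(3) s(1)] cmp_Mor[OF r(1) D(2)]] r(4) by simp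
  then show ?thesis unfolding is_biproduct_def using s r D(2,3,6) O by blast
qed

text \<open>A section of an epic in the opposite category is a retraction of the corresponding
  monic, and a conflation has one exactly when it has the other.\<close>

lemma op_all_split: "all_split (op_cat C) (\<E>\<inverse>) N M = all_split C \<E> M N"
proof
  assume split: "all_split (op_cat C) (\<E>\<inverse>) N M"
  show "all_split C \<E> M N"
    unfolding all_split_def
  proof (intro allI impI)
    fix L i p assume c: "conflation C \<E> N L M i p"
    then show "\<exists>s \<in> Mor C M L. p \<cdot> s = ident C M"
      using all_splitD[OF split, of L p i] section_of_retraction[OF c] by auto
  qed
next
  assume split: "all_split C \<E> M N"
  show "all_split (op_cat C) (\<E>\<inverse>) N M"
    unfolding all_split_def
  proof (intro allI impI)
    fix L p i assume "conflation (op_cat C) (\<E>\<inverse>) M L N p i"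
    then have c: "conflation C \<E> N L M i p" by simp
    then obtain s where "s \<in> Mor C M L" "p \<cdot> s = ident C M" using all_splitD[OF split] by blast
    then obtain r where "r \<in> Mor C L N" "r \<cdot> i = ident C N" using retraction_of_section[OF c] by blast
    then show "\<exists>s \<in> Mor (op_cat C) N L. i \<cdot>\<^bsub>op_cat C\<^esub> s = ident (op_cat C) N" by auto
  qed
qed

text \<open>Push the conflation out along h. A retraction of the new conflation, composed with the
  pushout morphism from P, extends h. This is exactness of Hom(P, N) -> Hom(L, N) -> Ext^1(M,
  N).\<close>

lemma all_split_extend:
  assumes split: "all_split C \<E> M N" and c: "conflation C \<E> L P M i p" and h: "h \<in> Mor C L N"
  shows "\<exists>g \<in> Mor C P N. g \<cdot> i = h"
proof -
  obtain Q j h' q where e: "conflation C \<E> N Q M j q" "h' \<in> Mor C P Q" "h' \<cdot> i = j \<cdot> h"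
    using pushout_conflation[OF c h] by blast
  obtain s where "s \<in> Mor C M Q" "q \<cdot> s = ident C M" using all_splitD[OF split e(1)] by blast
  then obtain r where r: "r \<in> Mor C Q N" "r \<cdot> j = ident C N"
    using retraction_of_section[OF e(1)] by blast
  have "(r \<cdot> h') \<cdot> i = h"
    using cmp_assoc[OF conflation_inj[OF c] e(2) r(1)] e(3)
      cmp_assoc[OF h conflation_inj[OF e(1)] r(1)] r(2) cmp_ident_left[OF h] by simp
  then show ?thesis using cmp_Mor[OF e(2) r(1)] by blast
qed

lemma all_split_lift:
  assumes "all_split C \<E> M N" "conflation C \<E> N P L i p" "h \<in> Mor C M L"
  shows "\<exists>g \<in> Mor C M P. p \<cdot> g = h"
  using exact_structure.all_split_extend[OF op_exact_structure, of N M L P p i h] assms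
  by (simp add: op_all_split)

lemma E_projective_lift:
  assumes "E_projective C \<E> P" "conflation C \<E> L M N i p" "f \<in> Mor C P N"
  shows "\<exists>g \<in> Mor C P M. p \<cdot> g = f"
proof -
  have "src C p = M" "tgt C p = N" using conflation_proj[OF assms(2)] by (auto simp: Mor_def)
  then show ?thesis
    using assms(1,3) conflation_adm_epic[OF assms(2)] unfolding E_projective_def by blast
qed

lemma E_injective_extend:
  assumes "E_injective C \<E> I" "conflation C \<E> L M N i p" "f \<in> Mor C L I"
  shows "\<exists>g \<in> Mor C M I. g \<cdot> i = f"
  using exact_structure.E_projective_lift[OF op_exact_structure, of I N M L p i f] assms by simp

text \<open>Converse of \<open>all_split_extend\<close> for projective P, so that one presentation
  of M tests all conflations ending in M. Lift e to u: P -> Q; on K it restricts to a morphism v: K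
  -> N, and v extends to g. Then u - j g kills K and descends to a section.\<close>

lemma all_split_of_extend:
  assumes k: "conflation C \<E> K P M k e" and P: "E_projective C \<E> P"
    and ext: "\<And>h. h \<in> Mor C K N \<Longrightarrow> \<exists>g \<in> Mor C P N. g \<cdot> k = h"
  shows "all_split C \<E> M N"
  unfolding all_split_def
proof (intro allI impI)
  fix Q j q assume c: "conflation C \<E> N Q M j q"
  note D = conflationD[OF c] and O = conflation_Ob[OF c] and D' = conflationD[OF k]
  obtain u where u: "u \<in> Mor C P Q" "q \<cdot> u = e" using E_projective_lift[OF P c D'(3)] by blast
  have "q \<cdot> (u \<cdot> k) = zero_ar C K M" using cmp_assoc[OF D'(2) u(1) D(3)] u(2) D'(6) by simp
  then obtain v where v: "v \<in> Mor C K N" "j \<cdot> v = u \<cdot> k"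
    using conflation_lift[OF c cmp_Mor[OF D'(2) u(1)]] by blast
  obtain g where g: "g \<in> Mor C P N" "g \<cdot> k = v" using ext[OF v(1)] by blast
  have jg: "j \<cdot> g \<in> Mor C P Q" using cmp_Mor[OF g(1) D(2)] .
  \<comment> \<open>Here d stands for u - j g.\<close>
  obtain d where d: "d \<in> Mor C P Q" "u = plus_ar C d (j \<cdot> g)" using diff_ex[OF u(1) jg] by blast
  have "(j \<cdot> g) \<cdot> k = u \<cdot> k" using cmp_assoc[OF D'(2) g(1) D(2)] g(2) v(2) by simp
  then have "plus_ar C (d \<cdot> k) (u \<cdot> k) = u \<cdot> k" using cmp_plus_left[OF D'(2) d(1) jg] d(2) by simp
  then have "d \<cdot> k = zero_ar C K Q"
    using plus_eq_self cmp_Mor[OF D'(2) d(1)] cmp_Mor[OF D'(2) u(1)] by blast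
  then obtain s where s: "s \<in> Mor C M Q" "s \<cdot> e = d" using conflation_extend[OF k d(1)] by blast
  have "q \<cdot> (j \<cdot> g) = zero_ar C P M"
    using cmp_assoc[OF g(1) D(2,3)] D(6) cmp_zero_left[OF g(1) O(3)] by simp
  then have "q \<cdot> d = e"
    using cmp_plus_right[OF d(1) jg D(3)] d(2) u(2) plus_zero[OF cmp_Mor[OF d(1) D(3)]] by simp
  then have "(q \<cdot> s) \<cdot> e = ident C M \<cdot> e"
    using cmp_assoc[OF D'(3) s(1) D(3)] s(2) cmp_ident_left[OF D'(3)] by simp
  then have "q \<cdot> s = ident C M"
    using is_epiD[OF D'(8) D'(3) cmp_Mor[OF s(1) D(3)]] ident_Mor O by blast
  then show "\<exists>s \<in> Mor C M Q. q \<cdot> s = ident C M" using s by blast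
qed

section \<open>Projective presentations and resolutions\<close>

lemma enough_E_projectives_conflation:
  assumes "enough_E_projectives C \<E>" "M \<in> Ob C"
  shows "\<exists>K P k e. conflation C \<E> K P M k e \<and> E_projective C \<E> P"
proof -
  obtain e k where e: "(k, e) \<in> \<E>" "E_projective C \<E> (src C e)" "tgt C e = M"
    using assms unfolding enough_E_projectives_def adm_epic_def by blast
  then have "conflation C \<E> (src C k) (tgt C k) M k e" using conflationI by blast
  moreover from this have "tgt C k = src C e" by (simp add: conflation_def Mor_def)
  ultimately show ?thesis using e by auto
qed

lemma enough_E_injectives_conflation:
  assumes "enough_E_injectives C \<E>" "M \<in> Ob C"
  shows "\<exists>I N i q. conflation C \<E> M I N i q \<and> E_injective C \<E> I"
  using exact_structure.enough_E_projectives_conflation[OF op_exact_structure, of M] assms by auto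

lemma E_projective_resolution_ex:
  assumes "enough_E_projectives C \<E>" "M \<in> Ob C"
  shows "\<exists>r. E_projective_resolution C \<E> M r"
proof -
  let ?Q = "\<lambda>A kp. conflation C \<E> (src C (fst kp)) (src C (snd kp)) A (fst kp) (snd kp) \<and>
    E_projective C \<E> (src C (snd kp))"
  have "\<exists>kp. ?Q A kp" if A: "A \<in> Ob C" for A
  proof -
    obtain K P k e where "conflation C \<E> K P A k e" "E_projective C \<E> P"
      using enough_E_projectives_conflation[OF assms(1) A] by blast
    moreover from this have "src C k = K" "src C e = P" by (auto simp: conflation_def Mor_def)
    ultimately show ?thesis by (intro exI[of _ "(k, e)"]) simp
  qed
  then obtain c where "\<And>A. A \<in> Ob C \<Longrightarrow> ?Q A (c A)" by metis
  then have c: "\<And>A. A \<in> Ob C \<Longrightarrow>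
      conflation C \<E> (src C (fst (c A))) (src C (snd (c A))) A (fst (c A)) (snd (c A))"
    "\<And>A. A \<in> Ob C \<Longrightarrow> E_projective C \<E> (src C (snd (c A)))"
    by blast+
  \<comment> \<open>With a presentation \<open>c A\<close> fixed for every object A, iterating "take
    the kernel" from M produces the syzygies.\<close>
  define K where "K = rec_nat M (\<lambda>_ A. src C (fst (c A)))"
  have K: "K n \<in> Ob C" for n
  proof (induction n)
    case (Suc n)
    then show ?case using conflation_Ob(1)[OF c(1)] by (simp add: K_def)
  qed (simp add: K_def assms)
  have "E_projective_resolution C \<E> M (\<lambda>n. c (K n))"
    unfolding E_projective_resolution_def
  proof (intro conjI allI)
    show "tgt C (snd (c (K 0))) = M"
      using conflation_proj[OF c(1)[OF K[of 0]]] by (simp add: Mor_def K_def)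
    fix n
    show "c (K n) \<in> \<E>" "E_projective C \<E> (src C (snd (c (K n))))"
      using conflation_in[OF c(1)[OF K]] c(2)[OF K] by auto
    show "src C (fst (c (K n))) = tgt C (snd (c (K (Suc n))))"
      using conflation_proj[OF c(1)[OF K[of "Suc n"]]] by (simp add: Mor_def K_def)
  qed
  then show ?thesis by blast
qed

lemma group_hom_precompose:
  assumes d: "d \<in> Mor C A B" and N: "N \<in> Ob C"
  shows "group_hom (Mor_group C B N) (Mor_group C A N) (\<lambda>f. f \<cdot> d)"
proof -
  have "comm_group (Mor_group C B N)" "comm_group (Mor_group C A N)"
    using Mor_comm_group Mor_Ob[OF d] N by auto
  moreover have "(\<lambda>f. f \<cdot> d) \<in> hom (Mor_group C B N) (Mor_group C A N)"
    using cmp_Mor[OF d] cmp_plus_left[OF d] by (auto simp: hom_def Mor_group_def)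
  ultimately show ?thesis
    by (simp add: group_hom_def group_hom_axioms_def comm_group_def)
qed

end

lemma (in comm_group) trivial_group_Mod_iff:
  assumes "subgroup H G"
  shows "trivial_group (G Mod H) \<longleftrightarrow> H = carrier G"
proof
  assume "trivial_group (G Mod H)"
  then have "carrier (G Mod H) = {H}" by (simp add: trivial_group_def FactGroup_def)
  then have "H #> x = H" if "x \<in> carrier G" for x using that by (auto simp: carrier_FactGroup)
  then have "carrier G \<subseteq> H" using coset_join1 assms by blast
  then show "H = carrier G" using subgroup.subset[OF assms] by blast
next
  assume H: "H = carrier G"
  then interpret normal H G using subgroup_imp_normal assms by blast
  have "carrier (G Mod H) = {H}"
    using H coset_join2[OF _ assms] one_closed by (auto simp: carrier_FactGroup)
  then show "trivial_group (G Mod H)" using group.trivial_group[OF factorgroup_is_group] by blast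
qed

section \<open>Vanishing of Ext^1 as a splitting condition\<close>

context exact_structure
begin

text \<open>Since \<open>p 2\<close> is epi, a 1-cocycle f kills \<open>i 1\<close> and therefore
  has the form h p_1 with h: K_1 -> N. A coboundary is (g i_0) p_1. As \<open>p 1\<close> is epi,
  the group vanishes iff every h: K_1 -> N extends along \<open>i 0\<close> to P_0, and this is the
  splitting criterion for the presentation K_1 -> P_0 -> M.\<close>

lemma trivial_Ext_iff:
  assumes proj: "enough_E_projectives C \<E>" and M: "M \<in> Ob C" and N: "N \<in> Ob C"
  shows "trivial_group (Ext C \<E> 1 M N) \<longleftrightarrow> all_split C \<E> M N"
proof -
  \<comment> \<open>This repeats the choice made inside \<open>Ext\<close>, so the group is computed
    from exactly this resolution.\<close>
  define r where "r = (SOME r. E_projective_resolution C \<E> M r)"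
  have res: "E_projective_resolution C \<E> M r"
    unfolding r_def using someI_ex[OF E_projective_resolution_ex[OF proj M]] .
  define P K i p where "P = (\<lambda>n. src C (snd (r n)))" and "K = (\<lambda>n. tgt C (snd (r n)))"
    and "i = (\<lambda>n. fst (r n))" and "p = (\<lambda>n. snd (r n))"
  have K0: "K 0 = M" using res by (simp add: E_projective_resolution_def K_def)
  have c: "conflation C \<E> (K (Suc n)) (P n) (K n) (i n) (p n)"
    and Pn: "E_projective C \<E> (P n)" for n
  proof -
    have "(i n, p n) \<in> \<E>" "src C (i n) = K (Suc n)" "E_projective C \<E> (P n)"
      using res by (simp_all add: E_projective_resolution_def i_def p_def P_def K_def)
    moreover have "tgt C (i n) = P n"
      using conflation_pair[OF \<open>(i n, p n) \<in> \<E>\<close>]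
      by (simp add: kernel_cokernel_pair_def is_kernel_def P_def p_def)
    ultimately show "conflation C \<E> (K (Suc n)) (P n) (K n) (i n) (p n)" "E_projective C \<E> (P n)"
      using conflationI[of "i n" "p n"] by (auto simp: K_def p_def)
  qed
  note D0 = conflationD[OF c[of 0]] and D1 = conflationD[OF c[of 1]] and D2 = conflationD[OF c[of 2]]
  have nums: "Suc 0 = 1" "Suc 1 = 2" by auto
  note D0 = D0[unfolded nums] and D1 = D1[unfolded nums]
  define d0 d1 where "d0 = i 0 \<cdot> p 1" and "d1 = i 1 \<cdot> p 2"
  have d0: "d0 \<in> Mor C (P 1) (P 0)" and d1: "d1 \<in> Mor C (P 2) (P 1)"
    unfolding d0_def d1_def using cmp_Mor D0(2) D1(2,3) D2(3) by blast+
  have pi: "p 1 \<cdot> d1 = zero_ar C (P 2) (K 1)"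
    unfolding d1_def using cmp_assoc[OF D2(3) D1(2,3)] D1(6) cmp_zero_left[OF D2(3)] Mor_Ob[OF D1(3)]
    by simp
  have "d0 \<cdot> d1 = zero_ar C (P 2) (P 0)"
    unfolding d0_def using cmp_assoc[OF d1 D1(3) D0(2)] pi cmp_zero_right[OF D0(2)] Mor_Ob[OF d1]
    by simp
  then have dd: "(g \<cdot> d0) \<cdot> d1 = zero_ar C (P 2) N" if "g \<in> Mor C (P 0) N" for g
    using cmp_assoc[OF d1 d0 that] cmp_zero_right[OF that] Mor_Ob[OF d1] by simp
  let ?G = "Mor_group C (P 1) N"
  let ?Z = "kernel ?G (Mor_group C (P 2) N) (\<lambda>f. f \<cdot> d1)"
  let ?B = "(\<lambda>g. g \<cdot> d0) ` Mor C (P 0) N"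
  have Z: "?Z = {f \<in> Mor C (P 1) N. f \<cdot> d1 = zero_ar C (P 2) N}"
    by (simp add: kernel_def Mor_group_def)
  interpret G: comm_group ?G using Mor_comm_group Mor_Ob[OF d0] N by blast
  interpret h1: group_hom ?G "Mor_group C (P 2) N" "\<lambda>f. f \<cdot> d1"
    using group_hom_precompose[OF d1 N] .
  interpret h0: group_hom "Mor_group C (P 0) N" ?G "\<lambda>f. f \<cdot> d0"
    using group_hom_precompose[OF d0 N] .
  have B: "subgroup ?B ?G" using h0.img_is_subgroup by (simp add: Mor_group_def)
  have BZ: "?B \<subseteq> ?Z" unfolding Z using cmp_Mor[OF d0] dd by auto
  \<comment> \<open>The quotient in \<open>Ext\<close> is formed inside the cocycles, so the
    subgroup property and commutativity must be established for that carrier.\<close>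
  have "subgroup ?B (?G\<lparr>carrier := ?Z\<rparr>)"
    using G.subgroup_incl[OF B h1.subgroup_kernel BZ] .
  moreover have "comm_group (?G\<lparr>carrier := ?Z\<rparr>)"
    using subgroup.subgroup_is_group[OF h1.subgroup_kernel G.group_axioms]
    by (rule group.group_comm_groupI) (use G.m_comm in \<open>auto simp: kernel_def\<close>)
  moreover have "Ext C \<E> 1 M N = (?G\<lparr>carrier := ?Z\<rparr>) Mod ?B"
    by (simp add: Ext_def Ext_res_def res_obj_def res_diff_def r_def[symmetric] P_def i_def p_def
        d0_def d1_def numeral_2_eq_2)
  ultimately have "trivial_group (Ext C \<E> 1 M N) \<longleftrightarrow> ?B = ?Z"
    using comm_group.trivial_group_Mod_iff by fastforce
  also have "\<dots> \<longleftrightarrow> all_split C \<E> M N"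
  proof
    assume B: "?B = ?Z"
    show "all_split C \<E> M N"
    proof (rule all_split_of_extend[OF c[of 0, unfolded K0 nums] Pn])
      fix h assume h: "h \<in> Mor C (K 1) N"
      have "(h \<cdot> p 1) \<cdot> d1 = zero_ar C (P 2) N"
        using cmp_assoc[OF d1 D1(3) h] pi cmp_zero_right[OF h] Mor_Ob[OF d1] by simp
      then have "h \<cdot> p 1 \<in> ?B" unfolding B Z using cmp_Mor[OF D1(3) h] by simp
      then obtain g where g: "g \<in> Mor C (P 0) N" "h \<cdot> p 1 = g \<cdot> d0" by blast
      then have "(g \<cdot> i 0) \<cdot> p 1 = h \<cdot> p 1"
        using cmp_assoc[OF D1(3) D0(2) g(1)] by (simp add: d0_def)
      then have "g \<cdot> i 0 = h" using is_epiD[OF D1(8,3) cmp_Mor[OF D0(2) g(1)] h] by simp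
      then show "\<exists>g \<in> Mor C (P 0) N. g \<cdot> i 0 = h" using g by blast
    qed
  next
    assume split: "all_split C \<E> M N"
    have "f \<in> ?B" if "f \<in> ?Z" for f
    proof -
      have f: "f \<in> Mor C (P 1) N" "f \<cdot> d1 = zero_ar C (P 2) N" using that unfolding Z by auto
      have "(f \<cdot> i 1) \<cdot> p 2 = zero_ar C (K 2) N \<cdot> p 2"
        using cmp_assoc[OF D2(3) D1(2) f(1)] f(2) cmp_zero_left[OF D2(3) N] by (simp add: d1_def)
      then have "f \<cdot> i 1 = zero_ar C (K 2) N"
        using is_epiD[OF D2(8,3) cmp_Mor[OF D1(2) f(1)]] zero_Mor Mor_Ob[OF D1(2)] N by blast
      then obtain h where h: "h \<in> Mor C (K 1) N" "h \<cdot> p 1 = f"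
        using D1(12)[OF f(1)] by blast
      obtain g where g: "g \<in> Mor C (P 0) N" "g \<cdot> i 0 = h"
        using all_split_extend[OF split c[of 0, unfolded K0 nums] h(1)] by blast
      have "f = g \<cdot> d0" using cmp_assoc[OF D1(3) D0(2) g(1)] g h by (simp add: d0_def)
      then show ?thesis using g by blast
    qed
    then show "?B = ?Z" using BZ by blast
  qed
  finally show ?thesis .
qed

end
section \<open>Cotorsion pairs\<close>

text \<open>Splitting counterparts of \<open>right_perp\<close> and \<open>left_perp\<close>:
  passing to \<open>op_cat\<close> exchanges \<open>right_orth\<close> and
  \<open>left_orth\<close>.\<close>

definition right_orth :: "('o, 'm) cat \<Rightarrow> ('m \<times> 'm) set \<Rightarrow> 'o set \<Rightarrow> 'o set" where
  "right_orth C \<E> X = {N \<in> Ob C. \<forall>M \<in> X. all_split C \<E> M N}"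

definition left_orth :: "('o, 'm) cat \<Rightarrow> ('m \<times> 'm) set \<Rightarrow> 'o set \<Rightarrow> 'o set" where
  "left_orth C \<E> Y = {M \<in> Ob C. \<forall>N \<in> Y. all_split C \<E> M N}"

text \<open>The factorisation property of a precover is left out because it follows by splitting
  once Y lies in \<open>right_orth C \<E> X\<close>.\<close>

definition special_precovers ::
  "('o, 'm) cat \<Rightarrow> ('m \<times> 'm) set \<Rightarrow> 'o set \<Rightarrow> 'o set \<Rightarrow> bool" where
  "special_precovers C \<E> X Y \<longleftrightarrow>
     (\<forall>A \<in> Ob C. \<exists>K M i p. conflation C \<E> K M A i p \<and> M \<in> X \<and> K \<in> Y)"

definition special_preenvelopes ::
  "('o, 'm) cat \<Rightarrow> ('m \<times> 'm) set \<Rightarrow> 'o set \<Rightarrow> 'o set \<Rightarrow> bool" where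
  "special_preenvelopes C \<E> Y X \<longleftrightarrow>
     (\<forall>A \<in> Ob C. \<exists>M K i p. conflation C \<E> A M K i p \<and> M \<in> Y \<and> K \<in> X)"

lemma op_special_precovers [simp]:
  "special_precovers (op_cat C) (\<E>\<inverse>) Y X = special_preenvelopes C \<E> Y X"
  unfolding special_precovers_def special_preenvelopes_def op_cat_simps op_conflation by blast

lemma op_special_preenvelopes [simp]:
  "special_preenvelopes (op_cat C) (\<E>\<inverse>) X Y = special_precovers C \<E> X Y"
  unfolding special_precovers_def special_preenvelopes_def op_cat_simps op_conflation by blast

section \<open>Closure properties of orthogonal classes, special approximations, and the
  equivalences\<close>

context exact_structure
begin

lemma op_left_orth: "left_orth (op_cat C) (\<E>\<inverse>) X = right_orth C \<E> X"
  by (simp add: left_orth_def right_orth_def op_all_split)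

lemma op_right_orth: "right_orth (op_cat C) (\<E>\<inverse>) Y = left_orth C \<E> Y"
  by (simp add: left_orth_def right_orth_def op_all_split)

lemma closed_under_E_extensions_iff:
  "closed_under_E_extensions C \<E> T \<longleftrightarrow>
    (\<forall>L M N i p. conflation C \<E> L M N i p \<longrightarrow> L \<in> T \<longrightarrow> N \<in> T \<longrightarrow> M \<in> T)"
  unfolding closed_under_E_extensions_def conflation_iff by auto

lemma E_resolving_iff:
  "E_resolving C \<E> T \<longleftrightarrow> (\<forall>P. E_projective C \<E> P \<longrightarrow> P \<in> T) \<and>
    (\<forall>L M N i p. conflation C \<E> L M N i p \<longrightarrow> L \<in> T \<longrightarrow> N \<in> T \<longrightarrow> M \<in> T) \<and>
    (\<forall>L M N i p. conflation C \<E> L M N i p \<longrightarrow> M \<in> T \<longrightarrow> N \<in> T \<longrightarrow> L \<in> T)"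
  unfolding E_resolving_def closed_under_E_extensions_iff unfolding conflation_iff by auto

lemma E_coresolving_iff:
  "E_coresolving C \<E> T \<longleftrightarrow> (\<forall>I. E_injective C \<E> I \<longrightarrow> I \<in> T) \<and>
    (\<forall>L M N i p. conflation C \<E> L M N i p \<longrightarrow> L \<in> T \<longrightarrow> N \<in> T \<longrightarrow> M \<in> T) \<and>
    (\<forall>L M N i p. conflation C \<E> L M N i p \<longrightarrow> L \<in> T \<longrightarrow> M \<in> T \<longrightarrow> N \<in> T)"
  unfolding E_coresolving_def closed_under_E_extensions_iff unfolding conflation_iff by auto

lemma op_E_resolving: "E_resolving (op_cat C) (\<E>\<inverse>) T = E_coresolving C \<E> T"
  unfolding E_coresolving_iff exact_structure.E_resolving_iff[OF op_exact_structure]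
    op_conflation op_E_projective by blast

lemma op_E_coresolving: "E_coresolving (op_cat C) (\<E>\<inverse>) T = E_resolving C \<E> T"
  unfolding E_resolving_iff exact_structure.E_coresolving_iff[OF op_exact_structure]
    op_conflation op_E_injective by blast

text \<open>Given h: K -> M, extend p h to P -> N and lift the result to u: P -> M. The error h - u
  k lands in L, where it also extends to P. This is exactness of Ext^1 in the middle.\<close>

lemma right_orth_extension:
  assumes proj: "enough_E_projectives C \<E>" and X: "X \<subseteq> Ob C"
    and c: "conflation C \<E> L M N i p" and L: "L \<in> right_orth C \<E> X" and N: "N \<in> right_orth C \<E> X"
  shows "M \<in> right_orth C \<E> X"
proof -
  note D = conflationD[OF c] and O = conflation_Ob[OF c]
  have "all_split C \<E> A M" if A: "A \<in> X" for A
  proof -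
    have split: "all_split C \<E> A L" "all_split C \<E> A N"
      using L N A by (auto simp: right_orth_def)
    obtain K P k e where k: "conflation C \<E> K P A k e" and P: "E_projective C \<E> P"
      using enough_E_projectives_conflation[OF proj] A X by blast
    note D' = conflationD[OF k]
    show ?thesis
    proof (rule all_split_of_extend[OF k P])
      fix h assume h: "h \<in> Mor C K M"
      obtain v where v: "v \<in> Mor C P N" "v \<cdot> k = p \<cdot> h"
        using all_split_extend[OF split(2) k cmp_Mor[OF h D(3)]] by blast
      obtain u where u: "u \<in> Mor C P M" "p \<cdot> u = v"
        using E_projective_lift[OF P c v(1)] by blast
      have uk: "u \<cdot> k \<in> Mor C K M" using cmp_Mor[OF D'(2) u(1)] .
      obtain d where d: "d \<in> Mor C K M" "h = plus_ar C d (u \<cdot> k)" using diff_ex[OF h uk] by blast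
      have "p \<cdot> (u \<cdot> k) = p \<cdot> h" using cmp_assoc[OF D'(2) u(1) D(3)] u(2) v(2) by simp
      then have "plus_ar C (p \<cdot> d) (p \<cdot> h) = p \<cdot> h" using cmp_plus_right[OF d(1) uk D(3)] d(2) by simp
      then have "p \<cdot> d = zero_ar C K N"
        using plus_eq_self[OF cmp_Mor[OF d(1) D(3)] cmp_Mor[OF h D(3)]] by blast
      then obtain t where t: "t \<in> Mor C K L" "i \<cdot> t = d" using conflation_lift[OF c d(1)] by blast
      obtain t' where t': "t' \<in> Mor C P L" "t' \<cdot> k = t"
        using all_split_extend[OF split(1) k t(1)] by blast
      have it: "i \<cdot> t' \<in> Mor C P M" using cmp_Mor[OF t'(1) D(2)] .
      have "plus_ar C (i \<cdot> t') u \<cdot> k = h"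
        using cmp_plus_left[OF D'(2) it u(1)] cmp_assoc[OF D'(2) t'(1) D(2)] t'(2) t(2) d(2) by simp
      then show "\<exists>g \<in> Mor C P M. g \<cdot> k = h" using plus_Mor[OF it u(1)] by blast
    qed
  qed
  then show ?thesis using O by (simp add: right_orth_def)
qed

lemma E_injective_right_orth:
  assumes "E_injective C \<E> I"
  shows "I \<in> right_orth C \<E> X"
proof -
  have I: "I \<in> Ob C" using assms by (simp add: E_injective_def)
  have "all_split C \<E> M I" for M
    unfolding all_split_def
  proof (intro allI impI)
    fix L i p assume c: "conflation C \<E> I L M i p"
    obtain r where "r \<in> Mor C L I" "r \<cdot> i = ident C I"
      using E_injective_extend[OF assms c ident_Mor[OF I]] by blast
    then show "\<exists>s \<in> Mor C M L. p \<cdot> s = ident C M" using section_of_retraction[OF c] by blast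
  qed
  then show ?thesis using I by (simp add: right_orth_def)
qed

text \<open>For the quotient N, dimension shifting trades Ext^2(A, L) for Ext^1(K, L). A morphism h:
  K -> N lifts to M because conflations of K by L split; the lift extends to P because those of A by
  M split; composing with p extends h.\<close>

lemma E_coresolving_right_orth:
  assumes proj: "enough_E_projectives C \<E>" and X: "X \<subseteq> Ob C" and res: "E_resolving C \<E> X"
  shows "E_coresolving C \<E> (right_orth C \<E> X)"
  unfolding E_coresolving_iff
proof (intro conjI allI impI)
  fix L M N i p assume c: "conflation C \<E> L M N i p"
    and L: "L \<in> right_orth C \<E> X" and M: "M \<in> right_orth C \<E> X"
  note D = conflationD[OF c] and O = conflation_Ob[OF c]
  have "all_split C \<E> A N" if A: "A \<in> X" for A
  proof -
    obtain K P k e where k: "conflation C \<E> K P A k e" and P: "E_projective C \<E> P"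
      using enough_E_projectives_conflation[OF proj] A X by blast
    \<comment> \<open>P lies in X as a projective, so K is the kernel of an admissible epic between
      objects of X.\<close>
    then have "K \<in> X" using res A unfolding E_resolving_iff by blast
    then have split: "all_split C \<E> K L" "all_split C \<E> A M"
      using L M A by (auto simp: right_orth_def)
    show ?thesis
    proof (rule all_split_of_extend[OF k P])
      fix h assume h: "h \<in> Mor C K N"
      obtain u where u: "u \<in> Mor C K M" "p \<cdot> u = h" using all_split_lift[OF split(1) c h] by blast
      obtain g where g: "g \<in> Mor C P M" "g \<cdot> k = u" using all_split_extend[OF split(2) k u(1)] by blast
      have "(p \<cdot> g) \<cdot> k = h" using cmp_assoc[OF conflation_inj[OF k] g(1) D(3)] g(2) u(2) by simp
      then show "\<exists>g \<in> Mor C P N. g \<cdot> k = h" using cmp_Mor[OF g(1) D(3)] by blast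
    qed
  qed
  then show "N \<in> right_orth C \<E> X" using O by (simp add: right_orth_def)
qed (use E_injective_right_orth right_orth_extension[OF proj X] in blast)+

lemma E_resolving_left_orth:
  assumes "enough_E_injectives C \<E>" "Y \<subseteq> Ob C" "E_coresolving C \<E> Y"
  shows "E_resolving C \<E> (left_orth C \<E> Y)"
  using exact_structure.E_coresolving_right_orth[OF op_exact_structure, of Y] assms
  by (simp add: op_right_orth op_E_coresolving op_E_resolving)

text \<open>The other side of a pullback square: \<open>pullback_conflation\<close> gives the
  conflation over q', and this gives the one over q. Parallel arrows of the square have the same
  kernel, and q is admissible as the pullback of p' along p.\<close>

lemma pullback_other_conflation:
  assumes c: "conflation C \<E> L M N i p" and c': "conflation C \<E> L' M' N i' p'"
    and q: "q \<in> Mor C D M" and q': "q' \<in> Mor C D M'" and pb: "is_pullback C p p' q q'"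
  shows "\<exists>k. conflation C \<E> L' D M k q"
proof -
  note D = conflationD[OF c] and O = conflation_Ob[OF c] and D' = conflationD[OF c']
    and O' = conflation_Ob[OF c']
  note univ = is_pullbackD[OF pb D(3) D'(3) q q']
  have sq: "p \<cdot> q = p' \<cdot> q'" using pb by (simp add: is_pullback_def)
  have "p \<cdot> zero_ar C L' M = p' \<cdot> i'" using D'(6) cmp_zero_right[OF D(3) O'(1)] by simp
  \<comment> \<open>The kernel L' of p' enters D through the pair (0, i').\<close>
  then obtain k where k: "k \<in> Mor C L' D" "q \<cdot> k = zero_ar C L' M" "q' \<cdot> k = i'"
    using univ[OF zero_Mor D'(2)] O O' by blast
  have "is_mono C k"
  proof (rule is_monoI[OF k(1)])
    fix T g h assume gh: "g \<in> Mor C T L'" "h \<in> Mor C T L'" "k \<cdot> g = k \<cdot> h"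
    have "i' \<cdot> g = i' \<cdot> h"
      using cmp_assoc[OF gh(1) k(1) q'] cmp_assoc[OF gh(2) k(1) q'] k(3) gh(3) by simp
    then show "g = h" using is_monoD[OF D'(7,2) gh(1,2)] by blast
  qed
  then have "is_kernel C k q"
  proof (rule is_kernelI[OF k(1) q k(2)])
    fix T t assume t: "t \<in> Mor C T D" "q \<cdot> t = zero_ar C T M"
    have T: "T \<in> Ob C" using t Mor_Ob by blast
    have "p' \<cdot> (q' \<cdot> t) = zero_ar C T N"
      using cmp_assoc[OF t(1) q' D'(3)] cmp_assoc[OF t(1) q D(3)] sq t(2) cmp_zero_right[OF D(3) T]
      by simp
    then obtain s where s: "s \<in> Mor C T L'" "i' \<cdot> s = q' \<cdot> t"
      using conflation_lift[OF c' cmp_Mor[OF t(1) q']] by blast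
    have ks: "q \<cdot> (k \<cdot> s) = zero_ar C T M" "q' \<cdot> (k \<cdot> s) = q' \<cdot> t"
      using cmp_assoc[OF s(1) k(1) q] cmp_assoc[OF s(1) k(1) q'] k(2,3) s(2)
        cmp_zero_left[OF s(1)] O by auto
    have "p \<cdot> (q \<cdot> t) = p' \<cdot> (q' \<cdot> t)"
      using cmp_assoc[OF t(1) q' D'(3)] cmp_assoc[OF t(1) q D(3)] sq by simp
    then have "k \<cdot> s = t"
      using univ[OF cmp_Mor[OF t(1) q] cmp_Mor[OF t(1) q']] ks t cmp_Mor[OF s(1) k(1)] by metis
    then show "\<exists>g \<in> Mor C T L'. k \<cdot> g = t" using s by blast
  qed
  moreover have "adm_epic \<E> q" using pullback_adm_epic[OF D'(10) is_pullback_swap[OF pb]] .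
  ultimately show ?thesis using conflation_of_kernel k(1) q by (auto simp: Mor_def)
qed

text \<open>Salce's trick: pull a special precover of \<open>N\<close> back along \<open>I \<rightarrow> N\<close>, where
  \<open>A \<rightarrow> I \<rightarrow> N\<close> is a conflation with \<open>I\<close> injective.\<close>

lemma special_preenvelopes_of_precovers:
  assumes proj: "enough_E_projectives C \<E>" and inj: "enough_E_injectives C \<E>" and X: "X \<subseteq> Ob C"
    and pre: "special_precovers C \<E> X (right_orth C \<E> X)"
  shows "special_preenvelopes C \<E> (right_orth C \<E> X) X"
  unfolding special_preenvelopes_def
proof
  fix A assume "A \<in> Ob C"
  then obtain I N a b where a: "conflation C \<E> A I N a b" and I: "E_injective C \<E> I"
    using enough_E_injectives_conflation[OF inj] by blast
  obtain K M i p where c: "conflation C \<E> K M N i p" and M: "M \<in> X" and K: "K \<in> right_orth C \<E> X"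
    using pre conflation_Ob(3)[OF a] unfolding special_precovers_def by blast
  obtain D j f q where d: "conflation C \<E> K D I j q" and f: "f \<in> Mor C D M"
    and pb: "is_pullback C p b f q"
    using pullback_conflation[OF c conflation_proj[OF a]] by blast
  obtain k where "conflation C \<E> A D M k f"
    using pullback_other_conflation[OF c a f conflation_proj[OF d] pb] by blast
  \<comment> \<open>D is an extension of the injective I by K, and both lie in the orthogonal
    class.\<close>
  moreover have "D \<in> right_orth C \<E> X"
    using right_orth_extension[OF proj X d K E_injective_right_orth[OF I]] .
  ultimately show "\<exists>M K i p. conflation C \<E> A M K i p \<and> M \<in> right_orth C \<E> X \<and> K \<in> X"
    using M by blast
qed

text \<open>A special precover of M has its kernel in \<open>right_orth C \<E> X\<close>, so it
  splits for M in the double orthogonal and exhibits M as a summand of an object of X.\<close>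

lemma left_orth_right_orth:
  assumes X: "X \<subseteq> Ob C" and summand: "\<forall>A B S. is_biproduct C A B S \<and> S \<in> X \<longrightarrow> A \<in> X"
    and pre: "special_precovers C \<E> X (right_orth C \<E> X)"
  shows "left_orth C \<E> (right_orth C \<E> X) = X"
proof
  show "X \<subseteq> left_orth C \<E> (right_orth C \<E> X)"
    using X by (auto simp: left_orth_def right_orth_def)
  show "left_orth C \<E> (right_orth C \<E> X) \<subseteq> X"
  proof
    fix M assume M: "M \<in> left_orth C \<E> (right_orth C \<E> X)"
    then obtain K B i p where c: "conflation C \<E> K B M i p" and B: "B \<in> X"
      and K: "K \<in> right_orth C \<E> X"
      using pre unfolding special_precovers_def left_orth_def by blast
    have "all_split C \<E> M K" using M K by (simp add: left_orth_def)
    then obtain s where "s \<in> Mor C M B" "p \<cdot> s = ident C M" using all_splitD[OF _ c] by blast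
    then have "is_biproduct C M K B" by (rule is_biproduct_of_section[OF c])
    then show "M \<in> X" using summand B by blast
  qed
qed

text \<open>Left to right, a morphism from X' in X lifts because conflations of X' by the kernel
  split. Right to left, the issue is that the epimorphism p must be shown to be admissible.\<close>

lemma special_precovers_iff:
  assumes proj: "enough_E_projectives C \<E>" and PX: "\<And>P. E_projective C \<E> P \<Longrightarrow> P \<in> X"
    and Y: "Y \<subseteq> right_orth C \<E> X"
  shows "special_precovers C \<E> X Y \<longleftrightarrow> (\<forall>A \<in> Ob C. \<exists>p. is_precover C X A p \<and> is_epi C p \<and>
    (\<exists>k. is_kernel C k p \<and> src C k \<in> Y))"
proof
  assume pre: "special_precovers C \<E> X Y"
  show "\<forall>A \<in> Ob C. \<exists>p. is_precover C X A p \<and> is_epi C p \<and> (\<exists>k. is_kernel C k p \<and> src C k \<in> Y)"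
  proof
    fix A assume "A \<in> Ob C"
    then obtain K M i p where c: "conflation C \<E> K M A i p" and M: "M \<in> X" and K: "K \<in> Y"
      using pre unfolding special_precovers_def by blast
    have ty: "p \<in> Ar C" "src C p = M" "tgt C p = A" "src C i = K"
      using conflation_proj[OF c] conflation_inj[OF c] by (auto simp: Mor_def)
    have "\<exists>g \<in> Mor C X' M. p \<cdot> g = f" if "X' \<in> X" "f \<in> Mor C X' A" for X' f
      using all_split_lift[OF _ c that(2)] Y K that(1) by (auto simp: right_orth_def)
    then have "is_precover C X A p" using ty M by (auto simp: is_precover_def)
    then show "\<exists>p. is_precover C X A p \<and> is_epi C p \<and> (\<exists>k. is_kernel C k p \<and> src C k \<in> Y)"
      using conflation_epi[OF c] conflation_is_kernel[OF c] ty K by blast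
  qed
next
  assume pre: "\<forall>A \<in> Ob C. \<exists>p. is_precover C X A p \<and> is_epi C p \<and>
    (\<exists>k. is_kernel C k p \<and> src C k \<in> Y)"
  show "special_precovers C \<E> X Y"
    unfolding special_precovers_def
  proof
    fix A assume A: "A \<in> Ob C"
    then obtain p k where p: "is_precover C X A p" "is_epi C p" "is_kernel C k p" "src C k \<in> Y"
      using pre by blast
    obtain L P i q where c: "conflation C \<E> L P A i q" and P: "E_projective C \<E> P"
      using enough_E_projectives_conflation[OF proj A] by blast
    define M where "M = src C p"
    have pm: "p \<in> Mor C M A" and M: "M \<in> X" using p by (auto simp: is_precover_def Mor_def M_def)
    \<comment> \<open>P is itself a test object of the precover, since projectives lie in X.\<close>
    obtain g where g: "g \<in> Mor C P M" "p \<cdot> g = q"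
      using p(1) PX[OF P] conflation_proj[OF c] unfolding is_precover_def M_def by blast
    show "\<exists>K M i p. conflation C \<E> K M A i p \<and> M \<in> X \<and> K \<in> Y"
      using adm_epic_of_cmp[OF c g(1) pm p(2) g(2) p(3)] M p(4) by blast
  qed
qed

text \<open>Equivalence of (1) and (3) in the self-dual vocabulary; its instance in the opposite
  category treats (2). Both sides contain "X resolving and Y orthogonal to X", so only that case has
  content.\<close>

lemma cotorsion_of_precovers_iff:
  assumes proj: "enough_E_projectives C \<E>" and inj: "enough_E_injectives C \<E>"
    and X: "X \<subseteq> Ob C" and summand: "\<forall>A B S. is_biproduct C A B S \<and> S \<in> X \<longrightarrow> A \<in> X"
  shows "E_resolving C \<E> X \<and> Y = right_orth C \<E> X \<and>
      (\<forall>A \<in> Ob C. \<exists>p. is_precover C X A p \<and> is_epi C p \<and> (\<exists>k. is_kernel C k p \<and> src C k \<in> Y)) \<longleftrightarrow>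
    E_resolving C \<E> X \<and> X = left_orth C \<E> Y \<and> Y = right_orth C \<E> X \<and>
      special_precovers C \<E> X Y \<and> special_preenvelopes C \<E> Y X"
proof (cases "E_resolving C \<E> X \<and> Y = right_orth C \<E> X")
  case True
  then have "special_precovers C \<E> X Y \<longleftrightarrow> (\<forall>A \<in> Ob C. \<exists>p. is_precover C X A p \<and> is_epi C p \<and>
    (\<exists>k. is_kernel C k p \<and> src C k \<in> Y))"
    by (intro special_precovers_iff[OF proj]) (auto simp: E_resolving_def)
  moreover have "special_precovers C \<E> X Y \<Longrightarrow> X = left_orth C \<E> Y \<and> special_preenvelopes C \<E> Y X"
    using special_preenvelopes_of_precovers[OF proj inj X] left_orth_right_orth[OF X summand] True
    by simp
  ultimately show ?thesis using True by blast
qed auto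

lemma cotorsion_of_preenvelopes_iff:
  assumes "enough_E_projectives C \<E>" "enough_E_injectives C \<E>"
    and "Y \<subseteq> Ob C" and "\<forall>A B S. is_biproduct C A B S \<and> S \<in> Y \<longrightarrow> A \<in> Y"
  shows "E_coresolving C \<E> Y \<and> X = left_orth C \<E> Y \<and>
      (\<forall>A \<in> Ob C. \<exists>j. is_preenvelope C Y A j \<and> is_mono C j \<and> (\<exists>c. is_cokernel C c j \<and> tgt C c \<in> X)) \<longleftrightarrow>
    E_coresolving C \<E> Y \<and> Y = right_orth C \<E> X \<and> X = left_orth C \<E> Y \<and>
      special_preenvelopes C \<E> Y X \<and> special_precovers C \<E> X Y"
  using exact_structure.cotorsion_of_precovers_iff[OF op_exact_structure, of Y X] assms
  by (simp add: op_E_resolving op_right_orth op_left_orth)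

lemma right_perp_eq:
  assumes "enough_E_projectives C \<E>" "X \<subseteq> Ob C"
  shows "right_perp C \<E> X = right_orth C \<E> X"
  using trivial_Ext_iff[OF assms(1)] assms(2) by (auto simp: right_perp_def right_orth_def)

lemma left_perp_eq:
  assumes "enough_E_projectives C \<E>" "Y \<subseteq> Ob C"
  shows "left_perp C \<E> Y = left_orth C \<E> Y"
  using trivial_Ext_iff[OF assms(1)] assms(2) by (auto simp: left_perp_def left_orth_def)

lemma complete_pair_iff:
  "complete_pair C \<E> X Y \<longleftrightarrow> special_precovers C \<E> X Y \<and> special_preenvelopes C \<E> Y X"
proof -
  have "(\<exists>K M i p. conflation C \<E> K M A i p \<and> M \<in> X \<and> K \<in> Y) \<longleftrightarrow>
      (\<exists>(i, p) \<in> \<E>. src C i \<in> Y \<and> tgt C i \<in> X \<and> tgt C p = A)"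
    "(\<exists>M K i p. conflation C \<E> A M K i p \<and> M \<in> Y \<and> K \<in> X) \<longleftrightarrow>
      (\<exists>(i, p) \<in> \<E>. src C i = A \<and> tgt C i \<in> Y \<and> tgt C p \<in> X)" for A
    unfolding conflation_iff by auto
  then show ?thesis
    unfolding complete_pair_def special_precovers_def special_preenvelopes_def by auto
qed

end

theorem theorem3p4:
  fixes C :: "('o, 'm) cat" and \<E> :: "('m \<times> 'm) set" and X Y :: "'o set"
  assumes "abelian_category C"
    and "exact_structure C \<E>"
    and "enough_E_projectives C \<E>"
    and "enough_E_injectives C \<E>"
    and "subcategory C X"
    and "subcategory C Y"
  defines "S1 \<equiv> E_resolving C \<E> X \<and> Y = right_perp C \<E> X \<and>
      (\<forall>A \<in> Ob C. \<exists>p. is_precover C X A p \<and> is_epi C p \<and> (\<exists>k. is_kernel C k p \<and> src C k \<in> Y))"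
    and "S2 \<equiv> E_coresolving C \<E> Y \<and> X = left_perp C \<E> Y \<and>
      (\<forall>A \<in> Ob C. \<exists>j. is_preenvelope C Y A j \<and> is_mono C j \<and> (\<exists>c. is_cokernel C c j \<and> tgt C c \<in> X))"
    and "S3 \<equiv> E_cotorsion_pair C \<E> X Y \<and> complete_pair C \<E> X Y \<and> hereditary_pair C \<E> X Y"
  shows "(S1 \<longleftrightarrow> S2) \<and> (S2 \<longleftrightarrow> S3)"
proof -
  interpret exact_structure C \<E> by fact
  have X: "X \<subseteq> Ob C" "\<forall>A B S. is_biproduct C A B S \<and> S \<in> X \<longrightarrow> A \<in> X"
    and Y: "Y \<subseteq> Ob C" "\<forall>A B S. is_biproduct C A B S \<and> S \<in> Y \<longrightarrow> A \<in> Y"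
    using assms(5,6) unfolding subcategory_def by blast+
  note perp = right_perp_eq[OF assms(3) X(1)] left_perp_eq[OF assms(3) Y(1)]
  have "S1 \<longleftrightarrow> S3"
    unfolding S1_def S3_def perp E_cotorsion_pair_def hereditary_pair_def complete_pair_iff
    using cotorsion_of_precovers_iff[OF assms(3,4) X, where Y = Y] by blast
  moreover have "S2 \<longleftrightarrow> E_cotorsion_pair C \<E> X Y \<and> complete_pair C \<E> X Y \<and> E_coresolving C \<E> Y"
    unfolding S2_def perp E_cotorsion_pair_def complete_pair_iff
    using cotorsion_of_preenvelopes_iff[OF assms(3,4) Y, where X = X] by blast
  \<comment> \<open>Each class is the orthogonal of the other, so both closure conditions pass
    across: one by enough projectives, the other dually by enough injectives.\<close>
  moreover have "E_coresolving C \<E> Y \<longleftrightarrow> E_resolving C \<E> X" if "E_cotorsion_pair C \<E> X Y"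
    using E_coresolving_right_orth[OF assms(3) X(1)] E_resolving_left_orth[OF assms(4) Y(1)] that
    unfolding E_cotorsion_pair_def perp by metis
  ultimately show ?thesis unfolding S3_def hereditary_pair_def by blast
qed

end
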